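(* Let $q\in\mathbb C$, $|q|=1$, and let $\eta=\Re q>0$. For $\kappa>0$ denote by $\tau_\kappa$ the state $\tau$ on $\mathfrak R$ which corresponds to the operator $T=\kappa^2\mathbf 1$ (defined in the context). Let $\gamma$ be the gamma random measure on $X$ with Laplace transform $$\mathbb E\big(e^{\langle f,\gamma\rangle}\big)=\exp\Big[-\frac1\eta\int_X\log\big(1-\sqrt\eta\,f(x)\big)\,m(dx)\Big],\qquad f\in C_0(X),\ f\le0.$$ Then, for any $f_1,\dots,f_n\in\mathscr D$, $$\lim_{\kappa\to\infty}\tau_\kappa\big(R(f_1)\cdots R(f_n)\big)=\lim_{\kappa\to\infty}\big(\kappa\sqrt{1+\eta\kappa^2}\big)^{-n}\tau_\kappa\big(\rho(f_1)\cdots\rho(f_n)\big)=\mathbb E\big(\langle f_1,\gamma\rangle\cdots\langle f_n,\gamma\rangle\big).$$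
   Context: $X=\mathbb R^d$, $d\ge2$, $m$ is the Lebesgue measure, $\mathscr D$ is the space of real-valued $C^\infty$ functions on $X$ with compact support, $C_0(X)$ the space of real-valued continuous functions with compact support. $\gamma$ is a random measure, i.e. a random variable with values in the Radon measures on $X$ (Borel $\sigma$-algebra of the vague topology), and $\langle f,\gamma\rangle=\int_Xf\,d\gamma$. $\mathscr D^{\odot_{\mathrm a}n}$ is the $n$-th symmetric algebraic tensor power of $\mathscr D$ (finite sums of functions $f_1\odot\dots\odot f_n$ on $X^n$, $\odot$ denoting symmetric tensor product), $\mathscr D^{\odot_{\mathrm a}0}=\mathbb R$, and $\mathscr F_{\mathrm{fin}}(\mathscr D)$ is the real vector space of finite sequences $F=(f^{(0)},f^{(1)},\dots,f^{(n)},0,0,\dots)$ with $f^{(i)}\in\mathscr D^{\odot_{\mathrm a}i}$. For $\kappa>0$ let $\beta=\sqrt{\eta+\kappa^{-2}}$. For $\varphi\in\mathscr D$ define the linear operator on $\mathscr F_{\mathrm{fin}}(\mathscr D)$ $$\hat R(\varphi)=a^+(\varphi)+(\beta+\beta^{-1}\eta)a^0(\varphi)+a_1^-(\varphi)+\eta a_2^-(\varphi)+\beta^{-1}\int_X\varphi(x)\,m(dx),$$ where $a^+(\varphi)f^{(n)}=\varphi\odot f^{(n)}$; $a^0(\varphi)f_1\odot\dots\odot f_n=\sum_{i=1}^nf_1\odot\dots\odot(\varphi f_i)\odot\dots\odot f_n$; $a_1^-(\varphi)f_1\odot\dots\odot f_n=\sum_{i=1}^n\int_X\varphi f_i\,dm\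 f_1\odot\dots\odot\check f_i\odot\dots\odot f_n$ ($\check f_i$: omitted); $a_2^-(\varphi)f_1\odot\dots\odot f_n=\sum_{i=1}^n\sum_{j\ne i}(\varphi f_if_j)\odot\bigodot_{l\ne i,j}f_l$. (The annihilation operators vanish on degree $0$, $a_2^-(\varphi)$ also on degree $1$, and $a^0(\varphi)$ on degree $0$.) The smeared particle density is $\rho(\varphi)=\kappa\sqrt{1+\eta\kappa^2}\,R(\varphi)$, where $R(\varphi)$ is represented on $\mathscr F_{\mathrm{fin}}(\mathscr D)$ by $\hat R(\varphi)$; the operators $\hat R(\varphi)$ commute. $\mathfrak R$ is the real commutative algebra generated by $\rho(\varphi)$, $\varphi\in\mathscr D$, and constants. For $r\in\mathfrak R$, let $F=(f^{(0)},f^{(1)},\dots)\in\mathscr F_{\mathrm{fin}}(\mathscr D)$ be the vector obtained by applying $r$ (via this representation, with the given $\kappa$) to $(1,0,0,\dots)$; then $\tau_\kappa(r):=f^{(0)}$. *)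

theory Defs
  imports "HOL-Probability.Probability" "HOL-Combinatorics.Permutations"
begin

definition compactly_supported :: "('a::topological_space \<Rightarrow> real) \<Rightarrow> bool" where
  "compactly_supported f \<longleftrightarrow> compact (closure {x. f x \<noteq> 0})"

definition C0 :: "('a::topological_space \<Rightarrow> real) set" where
  "C0 = {f. continuous_on UNIV f \<and> compactly_supported f}"

primrec Ck :: "nat \<Rightarrow> (real ^ 'd \<Rightarrow> real) \<Rightarrow> bool" where
  "Ck 0 f \<longleftrightarrow> continuous_on UNIV f"
| "Ck (Suc k) f \<longleftrightarrow> (\<forall>x. f differentiable (at x)) \<and>
     (\<forall>i. Ck k (\<lambda>x. frechet_derivative f (at x) (axis i 1)))"

definition test_functions :: "(real ^ 'd \<Rightarrow> real) set" where
  "test_functions = {f. (\<forall>k. Ck k f) \<and> compactly_supported f}"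

text \<open>On $\mathbb{R}^d$ the Radon measures are exactly the Borel measures that are finite on
  compact sets.\<close>

definition radon_measures :: "(real ^ 'd) measure set" where
  "radon_measures = {\<mu>. sets \<mu> = sets borel \<and> (\<forall>K. compact K \<longrightarrow> emeasure \<mu> K < \<infinity>)}"

definition vague_topology :: "(real ^ 'd) measure topology" where
  "vague_topology = topology_generated_by
     {{\<mu> \<in> radon_measures. (\<integral>x. f x \<partial>\<mu>) \<in> U} | f U. f \<in> C0 \<and> open U}"

definition random_measure :: "'w measure \<Rightarrow> ('w \<Rightarrow> (real ^ 'd) measure) \<Rightarrow> bool" where
  "random_measure P \<gamma> \<longleftrightarrow>
     \<gamma> \<in> measurable P (sigma radon_measures {U. openin vague_topology U})"

text \<open>A function on $X^n$ is represented by a function on lists over $X$ that vanishes on all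
  lists of length different from $n$.\<close>

type_synonym 'a nfun = "'a list \<Rightarrow> real"

definition sym_tensor :: "('a \<Rightarrow> real) list \<Rightarrow> 'a nfun" where
  "sym_tensor fs xs = (let n = length fs in
     if length xs = n
     then (\<Sum>\<sigma> | \<sigma> permutes {..<n}. \<Prod>i<n. (fs ! (\<sigma> i)) (xs ! i)) / fact n
     else 0)"

text \<open>The coefficients \<open>c\<close> matter only for \<open>n = 0\<close>, where they turn the multiples of the empty
  tensor into the whole of \<open>\<real>\<close>.\<close>

definition sym_power :: "nat \<Rightarrow> (real ^ 'd) nfun set" where
  "sym_power n = {(\<lambda>xs. \<Sum>k<N. c k * sym_tensor (fs k) xs) | (N::nat) c fs.
     \<forall>k<N. length (fs k) = n \<and> set (fs k) \<subseteq> test_functions}"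

text \<open>The linear map on the \<open>n\<close>-th symmetric power with prescribed values on the generators
  $f_1 \odot \dots \odot f_n$.\<close>

definition is_lin_ext :: "nat \<Rightarrow> ((real ^ 'd \<Rightarrow> real) list \<Rightarrow> (real ^ 'd) nfun)
    \<Rightarrow> ((real ^ 'd) nfun \<Rightarrow> (real ^ 'd) nfun) \<Rightarrow> bool" where
  "is_lin_ext n g A \<longleftrightarrow>
     A \<in> extensional (sym_power n) \<and>
     (\<forall>u\<in>sym_power n. \<forall>v\<in>sym_power n. A (\<lambda>xs. u xs + v xs) = (\<lambda>xs. A u xs + A v xs)) \<and>
     (\<forall>c. \<forall>u\<in>sym_power n. A (\<lambda>xs. c * u xs) = (\<lambda>xs. c * A u xs)) \<and>
     (\<forall>fs. length fs = n \<and> set fs \<subseteq> test_functions \<longrightarrow> A (sym_tensor fs) = g fs)"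

definition lin_ext :: "nat \<Rightarrow> ((real ^ 'd \<Rightarrow> real) list \<Rightarrow> (real ^ 'd) nfun)
    \<Rightarrow> (real ^ 'd) nfun \<Rightarrow> (real ^ 'd) nfun" where
  "lin_ext n g = (THE A. is_lin_ext n g A)"

text \<open>In each case \<open>n\<close> is the degree of the argument. The operators \<open>aminus1\<close> and \<open>aminus2\<close> lower
  the degree by one.\<close>

definition aplus :: "(real ^ 'd \<Rightarrow> real) \<Rightarrow> nat \<Rightarrow> (real ^ 'd) nfun \<Rightarrow> (real ^ 'd) nfun" where
  "aplus \<phi> n = lin_ext n (\<lambda>fs. sym_tensor (\<phi> # fs))"

definition azero :: "(real ^ 'd \<Rightarrow> real) \<Rightarrow> nat \<Rightarrow> (real ^ 'd) nfun \<Rightarrow> (real ^ 'd) nfun" where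
  "azero \<phi> n = lin_ext n (\<lambda>fs xs.
     \<Sum>i<n. sym_tensor (fs[i := (\<lambda>x. \<phi> x * (fs ! i) x)]) xs)"

definition aminus1 :: "(real ^ 'd \<Rightarrow> real) \<Rightarrow> nat \<Rightarrow> (real ^ 'd) nfun \<Rightarrow> (real ^ 'd) nfun" where
  "aminus1 \<phi> n = lin_ext n (\<lambda>fs xs.
     \<Sum>i<n. (\<integral>x. \<phi> x * (fs ! i) x \<partial>lborel) * sym_tensor (nths fs (- {i})) xs)"

definition aminus2 :: "(real ^ 'd \<Rightarrow> real) \<Rightarrow> nat \<Rightarrow> (real ^ 'd) nfun \<Rightarrow> (real ^ 'd) nfun" where
  "aminus2 \<phi> n = lin_ext n (\<lambda>fs xs.
     \<Sum>i<n. \<Sum>j\<in>{..<n} - {i}.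
       sym_tensor ((\<lambda>x. \<phi> x * (fs ! i) x * (fs ! j) x) # nths fs (- {i, j})) xs)"

text \<open>The prescriptions in the four definitions above do extend linearly, so the descriptions
  \<open>THE\<close> in them are well defined: see \<open>is_lin_ext_aplus\<close>, \<open>is_lin_ext_azero\<close>,
  \<open>is_lin_ext_aminus1\<close> and \<open>is_lin_ext_aminus2\<close> below.\<close>

definition permanent :: "('u \<Rightarrow> 'v \<Rightarrow> real) \<Rightarrow> 'u list \<Rightarrow> 'v list \<Rightarrow> real" where
  "permanent c us vs = (\<Sum>\<sigma> | \<sigma> permutes {..<length us}. \<Prod>i<length us. c (us ! \<sigma> i) (vs ! i))"

lemma sym_tensor_permanent:
  "sym_tensor fs xs = (if length xs = length fs then permanent (\<lambda>f. f) fs xs / fact (length fs) else 0)"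
  by (simp add: sym_tensor_def permanent_def Let_def)

lemma permanent_swap:
  assumes "length us = length vs"
  shows "permanent c us vs = permanent (\<lambda>v u. c u v) vs us"
proof -
  have "(\<Prod>i<length us. c (us ! inv \<sigma> i) (vs ! i)) = (\<Prod>i<length us. c (us ! i) (vs ! \<sigma> i))"
    if "\<sigma> permutes {..<length us}" for \<sigma>
    using prod.permute[OF that, of "\<lambda>i. c (us ! inv \<sigma> i) (vs ! i)"] that
    by (simp add: o_def permutes_inverses)
  then show ?thesis
    unfolding permanent_def assms[symmetric]
    by (subst sum_permutations_inverse) (auto intro!: sum.cong)
qed

lemma permanent_mset:
  assumes "mset us = mset us'"
  shows "permanent c us vs = permanent c us' vs"
proof -
  obtain p where p: "p permutes {..<length us'}" "permute_list p us' = us"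
    using mset_eq_permutation[OF assms] .
  have len: "length us = length us'" using p by auto
  have "permanent c us' vs = (\<Sum>\<sigma> | \<sigma> permutes {..<length us'}. \<Prod>i<length us'. c (us' ! (p \<circ> \<sigma>) i) (vs ! i))"
    unfolding permanent_def by (rule setum_permutations_compose_left[OF p(1)])
  also have "\<dots> = permanent c us vs"
    unfolding permanent_def len
  proof (intro sum.cong prod.cong refl)
    fix \<sigma> i assume a: "\<sigma> \<in> {\<sigma>. \<sigma> permutes {..<length us'}}" "i \<in> {..<length us'}"
    then have "\<sigma> i < length us'" using permutes_in_image by fastforce
    then show "c (us' ! (p \<circ> \<sigma>) i) (vs ! i) = c (us ! \<sigma> i) (vs ! i)"
      using p permute_list_nth by fastforce
  qed
  finally show ?thesis by simp
qed

lemma mset_nths: "mset (nths xs A) = image_mset ((!) xs) (mset_set {i. i < length xs \<and> i \<in> A})"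
proof (induction xs rule: rev_induct)
  case Nil then show ?case by simp
next
  case (snoc x xs)
  let ?B = "{i. i < length xs \<and> i \<in> A}"
  have e: "{i. i < length (xs @ [x]) \<and> i \<in> A} = (if length xs \<in> A then insert (length xs) ?B else ?B)"
    by (auto simp: less_Suc_eq)
  have "image_mset ((!) (xs @ [x])) (mset_set ?B) = image_mset ((!) xs) (mset_set ?B)"
    by (intro image_mset_cong) (auto simp: nth_append)
  then show ?case unfolding e using snoc by (simp add: nths_append)
qed

lemma mset_remove_nth:
  assumes "i < length xs"
  shows "mset xs = add_mset (xs ! i) (mset (nths xs (- {i})))"
proof -
  have "mset xs = image_mset ((!) xs) (mset_set {j. j < length xs \<and> j \<in> UNIV})"
    using mset_nths[of xs UNIV] by (simp add: nths_all)
  also have "{j. j < length xs \<and> j \<in> UNIV} = insert i {j. j < length xs \<and> j \<in> - {i}}"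
    using assms by auto
  finally show ?thesis by (simp add: mset_nths)
qed

lemma length_remove_nth: "i < length xs \<Longrightarrow> Suc (length (nths xs (- {i}))) = length xs"
  using arg_cong[OF mset_remove_nth, of i xs size] by simp

lemma permanent_snoc:
  assumes "length us = Suc m" "length vs = m"
  shows "permanent c us (vs @ [v]) = (\<Sum>b<Suc m. c (us ! b) v * permanent c (nths us (- {b})) vs)"
proof -
  have I: "{..<Suc m} = insert m {..<m}" by auto
  have "permanent c us (vs @ [v]) = (\<Sum>b<Suc m. \<Sum>q | q permutes {..<m}.
      \<Prod>i<Suc m. c (us ! (Transposition.transpose m b \<circ> q) i) ((vs @ [v]) ! i))"
    unfolding permanent_def assms I
    by (rule sum_over_permutations_insert[of "{..<m}" m
          "\<lambda>p. \<Prod>i\<in>insert m {..<m}. c (us ! p i) ((vs @ [v]) ! i)"]) auto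
  also have "\<dots> = (\<Sum>b<Suc m. c (us ! b) v * permanent c (nths us (- {b})) vs)"
  proof (intro sum.cong refl)
    fix b assume b: "b \<in> {..<Suc m}"
    define gs where "gs = map (\<lambda>k. us ! Transposition.transpose m b k) [0..<m]"
    have t: "Transposition.transpose m b permutes {..<Suc m}" using b by (auto intro: permutes_swap_id)
    have "mset (gs @ [us ! b]) = mset (permute_list (Transposition.transpose m b) us)"
      by (simp add: gs_def permute_list_def assms)
    also have "\<dots> = mset us" using t assms by simp
    also have "\<dots> = add_mset (us ! b) (mset (nths us (- {b})))"
      using b assms by (intro mset_remove_nth) auto
    finally have g: "mset gs = mset (nths us (- {b}))" by simp
    have "(\<Sum>q | q permutes {..<m}. \<Prod>i<Suc m. c (us ! (Transposition.transpose m b \<circ> q) i) ((vs @ [v]) ! i))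
       = (\<Sum>q | q permutes {..<m}. c (us ! b) v * (\<Prod>i<m. c (gs ! q i) (vs ! i)))"
    proof (intro sum.cong refl)
      fix q assume "q \<in> {q. q permutes {..<m}}"
      then have q: "q permutes {..<m}" by simp
      then have "q m = m" by (simp add: permutes_def)
      moreover have "(\<Prod>i<m. c (us ! (Transposition.transpose m b \<circ> q) i) ((vs @ [v]) ! i)) = (\<Prod>i<m. c (gs ! q i) (vs ! i))"
      proof (intro prod.cong refl)
        fix i assume i: "i \<in> {..<m}"
        then have "q i < m" using q permutes_in_image by fastforce
        then show "c (us ! (Transposition.transpose m b \<circ> q) i) ((vs @ [v]) ! i) = c (gs ! q i) (vs ! i)"
          using i assms by (simp add: gs_def nth_append)
      qed
      ultimately show "(\<Prod>i<Suc m. c (us ! (Transposition.transpose m b \<circ> q) i) ((vs @ [v]) ! i))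
         = c (us ! b) v * (\<Prod>i<m. c (gs ! q i) (vs ! i))"
        using assms by (simp add: nth_append)
    qed
    also have "\<dots> = c (us ! b) v * permanent c gs vs"
      by (simp add: permanent_def gs_def sum_distrib_left)
    also have "\<dots> = c (us ! b) v * permanent c (nths us (- {b})) vs" by (simp only: permanent_mset[OF g])
    finally show "(\<Sum>q | q permutes {..<m}. \<Prod>i<Suc m. c (us ! (Transposition.transpose m b \<circ> q) i) ((vs @ [v]) ! i))
       = c (us ! b) v * permanent c (nths us (- {b})) vs" .
  qed
  finally show ?thesis .
qed

lemma sym_tensor_mset: "mset fs = mset gs \<Longrightarrow> sym_tensor fs xs = sym_tensor gs xs"
  using permanent_mset[of fs gs "\<lambda>f. f" xs] by (auto simp: sym_tensor_permanent dest: mset_eq_length)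

lemma sym_tensor_snoc:
  assumes "length fs = Suc (length xs)"
  shows "real (length fs) * sym_tensor fs (xs @ [y])
     = (\<Sum>i<length fs. (fs ! i) y * sym_tensor (nths fs (- {i})) xs)"
proof -
  have "length (nths fs (- {i})) = length xs" if "i < length fs" for i
    using length_remove_nth[OF that] assms by simp
  then show ?thesis using assms
    by (simp add: sym_tensor_permanent permanent_snoc sum_divide_distrib divide_simps sum_distrib_left mult_ac)
qed

lemma sym_tensor_Cons:
  assumes "length xs = Suc (length fs)"
  shows "real (length xs) * sym_tensor (f # fs) xs
     = (\<Sum>k<length xs. f (xs ! k) * sym_tensor fs (nths xs (- {k})))"
proof -
  have l: "length (nths xs (- {k})) = length fs" if "k < length xs" for k
    using length_remove_nth[OF that] assms by simp
  have "permanent (\<lambda>f. f) (f # fs) xs = permanent (\<lambda>f. f) (fs @ [f]) xs" by (rule permanent_mset) simp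
  also have "\<dots> = (\<Sum>k<length xs. f (xs ! k) * permanent (\<lambda>v u. u v) (nths xs (- {k})) fs)"
    using assms by (subst permanent_swap) (simp_all add: permanent_snoc)
  also have "\<dots> = (\<Sum>k<length xs. f (xs ! k) * permanent (\<lambda>f. f) fs (nths xs (- {k})))"
    using l by (intro sum.cong refl) (simp add: permanent_swap[of fs])
  finally show ?thesis using assms l
    by (simp add: sym_tensor_permanent sum_divide_distrib divide_simps sum_distrib_left mult_ac)
qed

lemma sum_remove_nth:
  fixes H :: "'b \<Rightarrow> real"
  assumes i: "i < length fs"
  shows "(\<Sum>k<length (nths fs (- {i})). H (nths fs (- {i}) ! k) )
     = (\<Sum>j\<in>{..<length fs} - {i}. H (fs ! j))"
proof -
  have *: "(\<Sum>k<length gs. H (gs ! k)) = (\<Sum>g\<in>#mset gs. H g)" for gs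
    by (simp add: sum_mset_sum_list sum_list_sum_nth atLeast0LessThan flip: mset_map)
  have "(\<Sum>k<length (nths fs (- {i})). H (nths fs (- {i}) ! k)) = (\<Sum>g\<in>#mset (nths fs (- {i})). H g)"
    by (rule *)
  also have "\<dots> = (\<Sum>j\<in>{j. j < length fs \<and> j \<in> - {i}}. H (fs ! j))"
    by (simp add: mset_nths sum_unfold_sum_mset image_mset.compositionality o_def)
  also have "{j. j < length fs \<and> j \<in> - {i}} = {..<length fs} - {i}" by auto
  finally show ?thesis .
qed

lemma mset_remove_two:
  assumes "i < length fs" "j < length fs" "i \<noteq> j"
  shows "mset fs = {#fs ! i, fs ! j#} + mset (nths fs (- {i, j}))"
proof -
  have "mset fs = image_mset ((!) fs) (mset_set {j. j < length fs \<and> j \<in> UNIV})"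
    using mset_nths[of fs UNIV] by (simp add: nths_all)
  also have "{k. k < length fs \<and> k \<in> UNIV} = insert i (insert j {k. k < length fs \<and> k \<in> - {i,j}})"
    using assms by auto
  finally show ?thesis using assms by (simp add: mset_nths)
qed

lemma sym_tensor_snoc2:
  assumes "length fs = Suc (Suc (length xs))"
  shows "real (length fs) * real (length fs - 1) * sym_tensor fs (xs @ [y, z])
     = (\<Sum>i<length fs. \<Sum>j\<in>{..<length fs} - {i}. (fs ! i) z * (fs ! j) y * sym_tensor (nths fs (- {i,j})) xs)"
proof -
  have inner: "real (length fs - 1) * sym_tensor (nths fs (- {i})) (xs @ [y])
     = (\<Sum>j\<in>{..<length fs} - {i}. (fs ! j) y * sym_tensor (nths fs (- {i,j})) xs)"
    if i: "i < length fs" for i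
  proof -
    let ?gs = "nths fs (- {i})"
    define H where "H = (\<lambda>g. g y * sym_tensor (SOME hs. mset hs = mset ?gs - {#g#}) xs)"
    have some: "mset (SOME hs. mset hs = M) = M" for M :: "('a \<Rightarrow> real) multiset"
      using ex_mset[of M] by (rule someI_ex)
    have l: "length ?gs = Suc (length xs)" using length_remove_nth[OF i] assms by simp
    have "real (length fs - 1) * sym_tensor ?gs (xs @ [y])
       = (\<Sum>k<length ?gs. (?gs ! k) y * sym_tensor (nths ?gs (- {k})) xs)"
      using sym_tensor_snoc[of ?gs xs y] l assms by simp
    also have "\<dots> = (\<Sum>k<length ?gs. H (?gs ! k))"
      unfolding H_def
    proof (intro sum.cong refl arg_cong2[where f="(*)"] sym_tensor_mset)
      fix k assume "k \<in> {..<length ?gs}"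
      then show "mset (nths ?gs (- {k})) = mset (SOME hs. mset hs = mset ?gs - {#?gs ! k#})"
        using mset_remove_nth[of k ?gs] by (simp add: some)
    qed
    also have "\<dots> = (\<Sum>j\<in>{..<length fs} - {i}. H (fs ! j))" by (rule sum_remove_nth[OF i])
    also have "\<dots> = (\<Sum>j\<in>{..<length fs} - {i}. (fs ! j) y * sym_tensor (nths fs (- {i,j})) xs)"
      unfolding H_def
    proof (intro sum.cong refl arg_cong2[where f="(*)"] sym_tensor_mset)
      fix j assume "j \<in> {..<length fs} - {i}"
      then show "mset (SOME hs. mset hs = mset ?gs - {#fs ! j#}) = mset (nths fs (- {i,j}))"
        using mset_remove_nth[OF i] mset_remove_two[of i fs j] i
        by (simp add: some) (metis add_mset_remove_trivial)
    qed
    finally show ?thesis .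
  qed
  define M where "M = real (length fs - 1)"
  have "real (length fs) * sym_tensor fs ((xs @ [y]) @ [z])
     = (\<Sum>i<length fs. (fs ! i) z * sym_tensor (nths fs (- {i})) (xs @ [y]))"
    by (rule sym_tensor_snoc) (use assms in simp)
  then have "M * (real (length fs) * sym_tensor fs (xs @ [y, z]))
     = (\<Sum>i<length fs. (fs ! i) z * (M * sym_tensor (nths fs (- {i})) (xs @ [y])))"
    by (simp add: sum_distrib_left mult_ac)
  also have "\<dots> = (\<Sum>i<length fs. (fs ! i) z *
      (\<Sum>j\<in>{..<length fs} - {i}. (fs ! j) y * sym_tensor (nths fs (- {i,j})) xs))"
    unfolding M_def using inner by (intro sum.cong refl) simp
  finally show ?thesis by (simp add: M_def sum_distrib_left mult_ac)
qed

lemma sym_tensor_in: "length fs = n \<Longrightarrow> set fs \<subseteq> test_functions \<Longrightarrow> sym_tensor fs \<in> sym_power n"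
  unfolding sym_power_def
  by (intro CollectI exI[of _ 1] exI[of _ "\<lambda>_. 1"] exI[of _ "\<lambda>_. fs"]) auto

lemma sym_power_zero: "(\<lambda>_. 0) \<in> sym_power n"
  unfolding sym_power_def by (intro CollectI exI[of _ "0::nat"]) auto

lemma sym_power_scale: assumes "u \<in> sym_power n" shows "(\<lambda>xs. c * u xs) \<in> sym_power n"
proof -
  obtain N d fs where u: "u = (\<lambda>xs. \<Sum>k<N. d k * sym_tensor (fs k) xs)" "\<forall>k<(N::nat). length (fs k) = n \<and> set (fs k) \<subseteq> test_functions"
    using assms unfolding sym_power_def by auto
  then show ?thesis unfolding sym_power_def
    by (intro CollectI exI[of _ N] exI[of _ "\<lambda>k. c * d k"] exI[of _ fs]) (auto simp: sum_distrib_left mult_ac)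
qed

lemma sym_power_add:
  assumes "u \<in> sym_power n" "v \<in> sym_power n" shows "(\<lambda>xs. u xs + v xs) \<in> sym_power n"
proof -
  obtain N d fs where u: "u = (\<lambda>xs. \<Sum>k<N. d k * sym_tensor (fs k) xs)" "\<forall>k<(N::nat). length (fs k) = n \<and> set (fs k) \<subseteq> test_functions"
    using assms unfolding sym_power_def by auto
  obtain M e gs where v: "v = (\<lambda>xs. \<Sum>k<M. e k * sym_tensor (gs k) xs)" "\<forall>k<(M::nat). length (gs k) = n \<and> set (gs k) \<subseteq> test_functions"
    using assms unfolding sym_power_def by auto
  have s: "(\<Sum>k<N+M. h k) = (\<Sum>k<N. h k) + (\<Sum>k<M. h (N + k))" for h :: "nat \<Rightarrow> real"
    by (induction M) auto
  show ?thesis unfolding sym_power_def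
    using u v
    by (intro CollectI exI[of _ "N+M"] exI[of _ "\<lambda>k. if k < N then d k else e (k - N)"]
          exI[of _ "\<lambda>k. if k < N then fs k else gs (k - N)"]) (auto simp: s)
qed

lemma sym_power_induct [consumes 1, case_names zero add]:
  assumes "u \<in> sym_power n" and "P (\<lambda>_. 0)"
    and "\<And>c fs v. length fs = n \<Longrightarrow> set fs \<subseteq> test_functions \<Longrightarrow> v \<in> sym_power n \<Longrightarrow> P v
           \<Longrightarrow> P (\<lambda>xs. v xs + c * sym_tensor fs xs)"
  shows "P u"
proof -
  obtain N d fs where u: "u = (\<lambda>xs. \<Sum>k<N. d k * sym_tensor (fs k) xs)" "\<forall>k<(N::nat). length (fs k) = n \<and> set (fs k) \<subseteq> test_functions"
    using assms unfolding sym_power_def by auto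
  have "j \<le> N \<Longrightarrow> P (\<lambda>xs. \<Sum>k<j. d k * sym_tensor (fs k) xs)" for j
  proof (induction j)
    case (Suc j)
    have "(\<lambda>xs. \<Sum>k<j. d k * sym_tensor (fs k) xs) \<in> sym_power n"
      unfolding sym_power_def using u(2) Suc.prems
      by (intro CollectI exI[of _ j] exI[of _ d] exI[of _ fs]) auto
    then show ?case using assms(3)[of "fs j" _ "d j"] Suc u(2) by simp
  qed (simp add: assms)
  then show ?thesis using u by simp
qed

lemma is_lin_ext_unique:
  assumes "is_lin_ext n g A" "is_lin_ext n g B"
  shows "A = B"
proof (rule extensionalityI[of _ "sym_power n"])
  have D: "C (\<lambda>xs. v xs + c * sym_tensor fs xs) = (\<lambda>xs. C v xs + c * g fs xs)" 
    if "is_lin_ext n g C" "v \<in> sym_power n" "length fs = n" "set fs \<subseteq> test_functions" for C c v fs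
    using that sym_tensor_in[of fs n] sym_power_scale[of "sym_tensor fs" n c] unfolding is_lin_ext_def
    by simp
  have Z: "C (\<lambda>_. 0) = (\<lambda>_. 0)" if "is_lin_ext n g C" for C
  proof -
    have "\<forall>c. \<forall>u\<in>sym_power n. C (\<lambda>xs. c * u xs) = (\<lambda>xs. c * C u xs)"
      using that unfolding is_lin_ext_def by blast
    from bspec[OF spec[OF this, of 0] sym_power_zero] show ?thesis by simp
  qed
  fix u :: "(real ^ 'a) nfun" assume "u \<in> sym_power n"
  then show "A u = B u"
    by (induction rule: sym_power_induct) (simp_all add: D Z assms)
qed (use assms in \<open>auto simp: is_lin_ext_def\<close>)

lemma is_lin_ext_lin_extI:
  assumes "\<And>u v. u \<in> sym_power n \<Longrightarrow> v \<in> sym_power n \<Longrightarrow> K (\<lambda>xs. u xs + v xs) = (\<lambda>xs. K u xs + K v xs)"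
    and "\<And>c u. u \<in> sym_power n \<Longrightarrow> K (\<lambda>xs. c * u xs) = (\<lambda>xs. c * K u xs)"
    and "\<And>fs. length fs = n \<Longrightarrow> set fs \<subseteq> test_functions \<Longrightarrow> K (sym_tensor fs) = g fs"
  shows "is_lin_ext n g (lin_ext n g)"
proof -
  have "is_lin_ext n g (restrict K (sym_power n))"
    unfolding is_lin_ext_def
    using assms by (simp add: sym_power_add sym_power_scale sym_tensor_in)
  then have "\<exists>!A. is_lin_ext n g A" using is_lin_ext_unique by blast
  from theI'[OF this] show ?thesis unfolding lin_ext_def .
qed

lemma is_lin_ext_aplus:
  "is_lin_ext n (\<lambda>fs. sym_tensor (\<phi> # fs)) (aplus \<phi> n)"
  unfolding aplus_def
proof (rule is_lin_ext_lin_extI)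
  define K where "K = (\<lambda>(u :: (real^'a) nfun) xs. inverse (length xs) * (\<Sum>k<length xs. \<phi> (xs ! k) * u (nths xs (- {k}))))"
  show "K (\<lambda>xs. u xs + v xs) = (\<lambda>xs. K u xs + K v xs)" for u v
    by (simp add: K_def fun_eq_iff algebra_simps sum.distrib)
  show "K (\<lambda>xs. c * u xs) = (\<lambda>xs. c * K u xs)" for c u
    by (simp add: K_def fun_eq_iff sum_distrib_left mult_ac)
  fix fs :: "(real^'a \<Rightarrow> real) list" assume fs: "length fs = n"
  show "K (sym_tensor fs) = sym_tensor (\<phi> # fs)"
  proof
    fix xs
    show "K (sym_tensor fs) xs = sym_tensor (\<phi> # fs) xs"
    proof (cases "length xs = Suc (length fs)")
      case True
      have "real (length xs) * K (sym_tensor fs) xs = real (length xs) * sym_tensor (\<phi> # fs) xs"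
        unfolding sym_tensor_Cons[OF True] using True by (simp add: K_def)
      then show ?thesis using True by simp
    next
      case False
      have "sym_tensor fs (nths xs (- {k})) = 0" if "k < length xs" for k
        using length_remove_nth[OF that] False by (auto simp: sym_tensor_def)
      then show ?thesis using False by (simp add: K_def sym_tensor_permanent)
    qed
  qed
qed

lemma is_lin_ext_azero:
  "is_lin_ext n (\<lambda>fs xs. \<Sum>i<n. sym_tensor (fs[i := (\<lambda>x. \<phi> x * (fs ! i) x)]) xs) (azero \<phi> n)"
  unfolding azero_def
proof (rule is_lin_ext_lin_extI)
  define K where "K = (\<lambda>(u :: (real^'a) nfun) xs. (\<Sum>k<length xs. \<phi> (xs ! k)) * u xs)"
  show "K (\<lambda>xs. u xs + v xs) = (\<lambda>xs. K u xs + K v xs)" for u v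
    by (simp add: K_def fun_eq_iff algebra_simps)
  show "K (\<lambda>xs. c * u xs) = (\<lambda>xs. c * K u xs)" for c u
    by (simp add: K_def fun_eq_iff mult_ac)
  fix fs :: "(real^'a \<Rightarrow> real) list" assume fs: "length fs = n"
  show "K (sym_tensor fs) = (\<lambda>xs. \<Sum>i<n. sym_tensor (fs[i := (\<lambda>x. \<phi> x * (fs ! i) x)]) xs)"
  proof
    fix xs
    have "(\<Sum>i<n. permanent (\<lambda>f. f) (fs[i := (\<lambda>x. \<phi> x * (fs ! i) x)]) xs) = (\<Sum>k<n. \<phi> (xs ! k)) * permanent (\<lambda>f. f) fs xs"
      if "length xs = n"
    proof -
      have p: "(\<Prod>j<n. (fs[i := (\<lambda>x. \<phi> x * (fs ! i) x)] ! \<sigma> j) (xs ! j))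
         = \<phi> (xs ! inv \<sigma> i) * (\<Prod>j<n. (fs ! \<sigma> j) (xs ! j))"
        if s: "\<sigma> permutes {..<n}" and i: "i < n" for \<sigma> i
      proof -
        have k: "inv \<sigma> i < n" "\<sigma> (inv \<sigma> i) = i"
          using s i permutes_in_image[OF permutes_inv[OF s]] permutes_inverses[OF s] by auto
        have "(\<Prod>j<n. (fs[i := (\<lambda>x. \<phi> x * (fs ! i) x)] ! \<sigma> j) (xs ! j))
           = (\<Prod>j<n. (if j = inv \<sigma> i then \<phi> (xs ! j) else 1) * (fs ! \<sigma> j) (xs ! j))"
        proof (intro prod.cong refl)
          fix j assume "j \<in> {..<n}"
          then have "\<sigma> j < n" using s permutes_in_image by fastforce
          moreover have "\<sigma> j = i \<longleftrightarrow> j = inv \<sigma> i" using permutes_inverses[OF s] by metis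
          ultimately show "(fs[i := (\<lambda>x. \<phi> x * (fs ! i) x)] ! \<sigma> j) (xs ! j)
            = (if j = inv \<sigma> i then \<phi> (xs ! j) else 1) * (fs ! \<sigma> j) (xs ! j)"
            using fs by (auto simp: nth_list_update)
        qed
        then show ?thesis using k by (simp add: prod.distrib)
      qed
      have q: "(\<Sum>i<n. \<phi> (xs ! inv \<sigma> i)) = (\<Sum>k<n. \<phi> (xs ! k))" if s: "\<sigma> permutes {..<n}" for \<sigma>
        using sum.permute[OF permutes_inv[OF s], of "\<lambda>k. \<phi> (xs ! k)"] by (simp add: o_def)
      have "(\<Sum>i<n. permanent (\<lambda>f. f) (fs[i := (\<lambda>x. \<phi> x * (fs ! i) x)]) xs)
        = (\<Sum>i<n. \<Sum>\<sigma> | \<sigma> permutes {..<n}. \<phi> (xs ! inv \<sigma> i) * (\<Prod>j<n. (fs ! \<sigma> j) (xs ! j)))"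
        unfolding permanent_def using fs p by simp
      also have "\<dots> = (\<Sum>\<sigma> | \<sigma> permutes {..<n}. (\<Sum>i<n. \<phi> (xs ! inv \<sigma> i)) * (\<Prod>j<n. (fs ! \<sigma> j) (xs ! j)))"
        by (subst sum.swap) (simp add: sum_distrib_right)
      also have "\<dots> = (\<Sum>k<n. \<phi> (xs ! k)) * permanent (\<lambda>f. f) fs xs"
        using q fs by (simp add: permanent_def sum_distrib_left)
      finally show ?thesis .
    qed
    then show "K (sym_tensor fs) xs = (\<Sum>i<n. sym_tensor (fs[i := (\<lambda>x. \<phi> x * (fs ! i) x)]) xs)"
      using fs by (auto simp: K_def sym_tensor_permanent sum_divide_distrib[symmetric])
  qed
qed

lemma test_mult_integrable:
  assumes "\<phi> \<in> test_functions" "f \<in> test_functions"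
  shows "integrable lborel (\<lambda>x. \<phi> x * f x)"
proof -
  let ?S = "closure {x. \<phi> x \<noteq> 0}"
  have "continuous_on UNIV \<phi>" "continuous_on UNIV f"
    using assms by (auto simp: test_functions_def dest!: spec[of _ 0])
  then have "continuous_on ?S (\<lambda>x. \<phi> x * f x)" by (intro continuous_intros) (auto intro: continuous_on_subset)
  moreover have "compact ?S" using assms by (simp add: test_functions_def compactly_supported_def)
  ultimately have "integrable lborel (\<lambda>x. indicator ?S x *\<^sub>R (\<phi> x * f x))"
    by (intro borel_integrable_compact)
  moreover have "(\<lambda>x. indicator ?S x *\<^sub>R (\<phi> x * f x)) = (\<lambda>x. \<phi> x * f x)"
  proof
    fix x
    show "indicator ?S x *\<^sub>R (\<phi> x * f x) = \<phi> x * f x"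
      using closure_subset[of "{x. \<phi> x \<noteq> 0}"] by (cases "\<phi> x = 0") auto
  qed
  ultimately show ?thesis by simp
qed

lemma is_lin_ext_aminus1:
  assumes "\<phi> \<in> test_functions"
  shows "is_lin_ext n (\<lambda>fs xs. \<Sum>i<n. (\<integral>x. \<phi> x * (fs ! i) x \<partial>lborel) * sym_tensor (nths fs (- {i})) xs) (aminus1 \<phi> n)"
  unfolding aminus1_def
proof (rule is_lin_ext_lin_extI)
  define K where "K = (\<lambda>(u :: (real^'a) nfun) xs. n * (\<integral>y. \<phi> y * u (xs @ [y]) \<partial>lborel))"
  have exp: "n * sym_tensor fs (xs @ [y]) = (\<Sum>i<n. (fs ! i) y * sym_tensor (nths fs (- {i})) xs)"
    if "length fs = n" for fs :: "(real^'a \<Rightarrow> real) list" and xs y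
  proof (cases "n = Suc (length xs)")
    case True then show ?thesis using sym_tensor_snoc[of fs xs y] that by simp
  next
    case False
    have "sym_tensor (nths fs (- {i})) xs = 0" if "i < n" for i
      using length_remove_nth[of i fs] False that \<open>length fs = n\<close> by (auto simp: sym_tensor_def)
    then show ?thesis using that False by (simp add: sym_tensor_permanent)
  qed
  have I: "integrable lborel (\<lambda>y. \<phi> y * (n * u (xs @ [y])))" if "u \<in> sym_power n" for u :: "(real^'a) nfun" and xs
    using that
  proof (induction rule: sym_power_induct)
    case (add c fs v)
    have "integrable lborel (\<lambda>y. \<Sum>i<n. c * sym_tensor (nths fs (- {i})) xs * (\<phi> y * (fs ! i) y))"
      using assms add by (intro Bochner_Integration.integrable_sum integrable_mult_right test_mult_integrable) auto
    then have "integrable lborel (\<lambda>y. \<phi> y * (c * (\<Sum>i<n. (fs ! i) y * sym_tensor (nths fs (- {i})) xs)))"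
      by (simp add: sum_distrib_left mult_ac)
    then have "integrable lborel (\<lambda>y. \<phi> y * (c * (n * sym_tensor fs (xs @ [y]))))"
      by (simp add: exp add)
    from Bochner_Integration.integrable_add[OF add(4) this]
    have "integrable lborel (\<lambda>y. \<phi> y * (n * v (xs @ [y])) + \<phi> y * (c * (n * sym_tensor fs (xs @ [y]))))" .
    moreover have "(\<lambda>y. \<phi> y * (n * v (xs @ [y])) + \<phi> y * (c * (n * sym_tensor fs (xs @ [y]))))
       = (\<lambda>y. \<phi> y * (n * (v (xs @ [y]) + c * sym_tensor fs (xs @ [y]))))"
      by (simp add: algebra_simps)
    ultimately show ?case by simp
  qed simp
  have K: "K u xs = (\<integral>y. \<phi> y * (n * u (xs @ [y])) \<partial>lborel)" for u :: "(real^'a) nfun" and xs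
    unfolding K_def by (simp add: mult.left_commute)
  show "K (\<lambda>xs. u xs + v xs) = (\<lambda>xs. K u xs + K v xs)" if "u \<in> sym_power n" "v \<in> sym_power n" for u v
    unfolding K using I[OF that(1)] I[OF that(2)]
    by (simp add: distrib_left del: mult_eq_0_iff)
  show "K (\<lambda>xs. c * u xs) = (\<lambda>xs. c * K u xs)" for c u
    by (simp add: K_def fun_eq_iff mult.left_commute[of _ c])
  fix fs :: "(real^'a \<Rightarrow> real) list" assume fs: "length fs = n" "set fs \<subseteq> test_functions"
  show "K (sym_tensor fs) = (\<lambda>xs. \<Sum>i<n. (\<integral>x. \<phi> x * (fs ! i) x \<partial>lborel) * sym_tensor (nths fs (- {i})) xs)"
  proof
    fix xs
    have "K (sym_tensor fs) xs = (\<integral>y. (\<Sum>i<n. \<phi> y * (fs ! i) y * sym_tensor (nths fs (- {i})) xs) \<partial>lborel)"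
      unfolding K exp[OF fs(1)] by (simp add: sum_distrib_left mult_ac)
    also have "\<dots> = (\<Sum>i<n. (\<integral>x. \<phi> x * (fs ! i) x \<partial>lborel) * sym_tensor (nths fs (- {i})) xs)"
      using fs assms
      by (subst Bochner_Integration.integral_sum) (auto intro!: integrable_mult_left test_mult_integrable)
    finally show "K (sym_tensor fs) xs = \<dots>" .
  qed
qed

lemma is_lin_ext_aminus2:
  "is_lin_ext n (\<lambda>fs xs. \<Sum>i<n. \<Sum>j\<in>{..<n} - {i}.
       sym_tensor ((\<lambda>x. \<phi> x * (fs ! i) x * (fs ! j) x) # nths fs (- {i, j})) xs) (aminus2 \<phi> n)"
  unfolding aminus2_def
proof (rule is_lin_ext_lin_extI)
  define K where "K = (\<lambda>(u :: (real^'a) nfun) xs. n * (\<Sum>k<length xs. \<phi> (xs ! k) * u (nths xs (- {k}) @ [xs ! k, xs ! k])))"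
  show "K (\<lambda>xs. u xs + v xs) = (\<lambda>xs. K u xs + K v xs)" for u v
    by (simp add: K_def fun_eq_iff algebra_simps sum.distrib)
  show "K (\<lambda>xs. c * u xs) = (\<lambda>xs. c * K u xs)" for c u
    by (simp add: K_def fun_eq_iff sum_distrib_left mult_ac)
  fix fs :: "(real^'a \<Rightarrow> real) list" assume fs: "length fs = n"
  show "K (sym_tensor fs) = (\<lambda>xs. \<Sum>i<n. \<Sum>j\<in>{..<n} - {i}.
       sym_tensor ((\<lambda>x. \<phi> x * (fs ! i) x * (fs ! j) x) # nths fs (- {i, j})) xs)"
  proof
    fix xs
    have l2: "Suc (Suc (length (nths fs (- {i, j})))) = n" if "i < n" "j \<in> {..<n} - {i}" for i j
      using arg_cong[OF mset_remove_two[of i fs j], of size] that fs by auto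
    show "K (sym_tensor fs) xs = (\<Sum>i<n. \<Sum>j\<in>{..<n} - {i}.
       sym_tensor ((\<lambda>x. \<phi> x * (fs ! i) x * (fs ! j) x) # nths fs (- {i, j})) xs)" (is "_ = ?R")
    proof (cases "n = Suc (length xs) \<and> xs \<noteq> []")
      case False
      have "?R = 0"
      proof (intro sum.neutral ballI)
        fix i j assume i: "i \<in> {..<n}" and j: "j \<in> {..<n} - {i}"
        have n: "Suc (Suc (length (nths fs (- {i, j})))) = n" using l2[of i j] i j by auto
        have "length xs \<noteq> Suc (length (nths fs (- {i, j})))"
          using False n by auto
        then show "sym_tensor ((\<lambda>x. \<phi> x * (fs ! i) x * (fs ! j) x) # nths fs (- {i, j})) xs = 0"
          by (simp add: sym_tensor_permanent)
      qed
      moreover have "sym_tensor fs (nths xs (- {k}) @ [xs ! k, xs ! k]) = 0" if "k < length xs" for k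
        using length_remove_nth[OF that] False fs that by (auto simp: sym_tensor_permanent)
      ultimately show ?thesis by (simp add: K_def)
    next
      case True
      let ?m = "length xs"
      have m: "real ?m \<noteq> 0" "n = Suc ?m" using True by auto
      have "?m * ?R = (\<Sum>i<n. \<Sum>j\<in>{..<n} - {i}. \<Sum>k<?m. \<phi> (xs ! k) * (fs ! i) (xs ! k) * (fs ! j) (xs ! k)
              * sym_tensor (nths fs (- {i, j})) (nths xs (- {k})))"
        unfolding sum_distrib_left using l2 m by (intro sum.cong refl, subst sym_tensor_Cons) auto
      also have "\<dots> = (\<Sum>k<?m. \<Sum>i<n. \<Sum>j\<in>{..<n} - {i}. \<phi> (xs ! k) * (fs ! i) (xs ! k) * (fs ! j) (xs ! k)
              * sym_tensor (nths fs (- {i, j})) (nths xs (- {k})))"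
        by (simp only: sum.swap[of _ "{..<?m}" "{..<n}"] sum.swap[of _ "{..<?m}" "{..<n} - {_}"])
      also have "\<dots> = (\<Sum>k<?m. \<phi> (xs ! k) * (n * ?m * sym_tensor fs (nths xs (- {k}) @ [xs ! k, xs ! k])))"
      proof (intro sum.cong refl)
        fix k assume "k \<in> {..<?m}"
        then have "length fs = Suc (Suc (length (nths xs (- {k}))))" using length_remove_nth[of k xs] fs m by simp
        note e = sym_tensor_snoc2[OF this, of "xs ! k" "xs ! k"]
        have n1: "n - 1 = ?m" using m by simp
        show "(\<Sum>i<n. \<Sum>j\<in>{..<n} - {i}. \<phi> (xs ! k) * (fs ! i) (xs ! k) * (fs ! j) (xs ! k)
              * sym_tensor (nths fs (- {i, j})) (nths xs (- {k})))
           = \<phi> (xs ! k) * (n * ?m * sym_tensor fs (nths xs (- {k}) @ [xs ! k, xs ! k]))"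
          unfolding of_nat_mult e[unfolded fs n1] by (simp add: sum_distrib_left mult_ac)
      qed
      also have "\<dots> = ?m * K (sym_tensor fs) xs"
        by (simp add: K_def sum_distrib_left mult_ac)
      finally show ?thesis using m by simp
    qed
  qed
qed

type_synonym 'a fock = "nat \<Rightarrow> 'a nfun"

definition Ffin :: "(real ^ 'd) fock set" where
  "Ffin = {F. (\<forall>n. F n \<in> sym_power n) \<and> (\<exists>N. \<forall>n>N. F n = (\<lambda>_. 0))}"

definition vac :: "(real ^ 'd) fock" where
  "vac n = (if n = 0 then sym_tensor [] else (\<lambda>_. 0))"

definition beta :: "real \<Rightarrow> real \<Rightarrow> real" where
  "beta \<eta> \<kappa> = sqrt (\<eta> + 1 / \<kappa>\<^sup>2)"

text \<open>Operators on \<open>Ffin\<close> are extensional functions, multiplied by \<open>compose Ffin\<close>.\<close>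

type_synonym 'a oper = "'a fock \<Rightarrow> 'a fock"

definition Rhat :: "real \<Rightarrow> real \<Rightarrow> (real ^ 'd \<Rightarrow> real) \<Rightarrow> (real ^ 'd) oper" where
  "Rhat \<eta> \<kappa> \<phi> = (\<lambda>F\<in>Ffin. \<lambda>n xs.
      (if n = 0 then 0 else aplus \<phi> (n - 1) (F (n - 1)) xs)
    + (beta \<eta> \<kappa> + inverse (beta \<eta> \<kappa>) * \<eta>) * azero \<phi> n (F n) xs
    + aminus1 \<phi> (n + 1) (F (n + 1)) xs
    + \<eta> * aminus2 \<phi> (n + 1) (F (n + 1)) xs
    + inverse (beta \<eta> \<kappa>) * (\<integral>x. \<phi> x \<partial>lborel) * F n xs)"

definition op_const :: "real \<Rightarrow> (real ^ 'd) oper" where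
  "op_const c = (\<lambda>F\<in>Ffin. \<lambda>n xs. c * F n xs)"

definition op_add :: "(real ^ 'd) oper \<Rightarrow> (real ^ 'd) oper \<Rightarrow> (real ^ 'd) oper" where
  "op_add A B = (\<lambda>F\<in>Ffin. \<lambda>n xs. A F n xs + B F n xs)"

definition op_scale :: "real \<Rightarrow> (real ^ 'd) oper \<Rightarrow> (real ^ 'd) oper" where
  "op_scale c A = (\<lambda>F\<in>Ffin. \<lambda>n xs. c * A F n xs)"

definition op_prod_list :: "(real ^ 'd) oper list \<Rightarrow> (real ^ 'd) oper" where
  "op_prod_list As = foldr (compose Ffin) As (op_const 1)"

definition rho :: "real \<Rightarrow> real \<Rightarrow> (real ^ 'd \<Rightarrow> real) \<Rightarrow> (real ^ 'd) oper" where
  "rho \<eta> \<kappa> \<phi> = op_scale (\<kappa> * sqrt (1 + \<eta> * \<kappa>\<^sup>2)) (Rhat \<eta> \<kappa> \<phi>)"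

inductive_set density_algebra :: "real \<Rightarrow> real \<Rightarrow> (real ^ 'd) oper set" for \<eta> \<kappa> where
  rho: "\<phi> \<in> test_functions \<Longrightarrow> rho \<eta> \<kappa> \<phi> \<in> density_algebra \<eta> \<kappa>"
| const: "op_const c \<in> density_algebra \<eta> \<kappa>"
| add: "A \<in> density_algebra \<eta> \<kappa> \<Longrightarrow> B \<in> density_algebra \<eta> \<kappa> \<Longrightarrow> op_add A B \<in> density_algebra \<eta> \<kappa>"
| mult: "A \<in> density_algebra \<eta> \<kappa> \<Longrightarrow> B \<in> density_algebra \<eta> \<kappa> \<Longrightarrow> compose Ffin A B \<in> density_algebra \<eta> \<kappa>"

text \<open>An element of the algebra is identified with the operator representing it, so the dependence
  on \<open>\<kappa>\<close> lies in the operators and in the domain of \<open>tau\<close>. The value is the degree-zero component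
  of the image of the vacuum.\<close>

definition tau :: "real \<Rightarrow> real \<Rightarrow> (real ^ 'd) oper \<Rightarrow> real" where
  "tau \<eta> \<kappa> = (\<lambda>A\<in>density_algebra \<eta> \<kappa>. A vac 0 [])"

end

theory Submission
  imports Defs
begin

text \<open>Put \<open>s = sqrt \<eta>\<close>. As \<open>\<kappa> \<rightarrow> \<infinity>\<close>, \<open>R(\<phi>)\<close> tends to
  \<open>a\<^sup>+(\<phi>) + 2 s a\<^sup>0(\<phi>) + a\<^sub>1(\<phi>) + s\<^sup>2 a\<^sub>2(\<phi>) + (1/s) \<integral>\<phi>\<close>. For these limit operators
  \<open>D(g) = s a\<^sup>0(g) + a\<^sub>1(g) + s\<^sup>2 a\<^sub>2(g)\<close> satisfies \<open>[D(g), R(f)] = s R(g f)\<close>, annihilates the vacuum, and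
  \<open>R(g) - (1/s) \<integral>g\<close> and \<open>D(g)\<close> have the same vacuum component on every vector. Hence the vacuum moments obey
  \<open>M(g, f\<^sub>1, \<dots>, f\<^sub>n) = (1/s) \<integral>g M(f\<^sub>1, \<dots>, f\<^sub>n) + s \<Sum>\<^sub>i M(f\<^sub>1, \<dots>, g f\<^sub>i, \<dots>, f\<^sub>n)\<close>, which determines them.

  The gamma measure obeys the same recursion. Differentiating the Laplace transform at \<open>h\<close> in the direction
  \<open>g (1 - s h)\<close> yields an integration by parts formula for the weight \<open>exp \<langle>h, \<gamma>\<rangle>\<close>; further derivatives in \<open>h\<close> insert
  the factors \<open>\<langle>f\<^sub>i, \<gamma>\<rangle>\<close>. With \<open>h = - r g\<^sub>0\<close>, \<open>g\<^sub>0\<close> dominating all the functions involved, every moment is finite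
  for \<open>r > 0\<close>, the formula bounds the moments uniformly in \<open>r\<close>, and \<open>r \<rightarrow> 0\<close> gives the recursion.\<close>

section \<open>Operators dual to the annihilation and neutral operators\<close>

text \<open>A function \<open>\<Phi>\<close> on lists stands for the values of a linear functional on the vectors
  \<open>f\<^sub>1 \<odot> \<dots> \<odot> f\<^sub>n\<close>; an operator on Fock space acts on it by precomposition. The recursions on the list are the
  commutation relations with \<open>a\<^sup>+(h)\<close>.\<close>

fun dual_azero :: "('x \<Rightarrow> real) \<Rightarrow> (('x \<Rightarrow> real) list \<Rightarrow> real) \<Rightarrow> ('x \<Rightarrow> real) list \<Rightarrow> real" where
  "dual_azero \<phi> \<Phi> [] = 0"
| "dual_azero \<phi> \<Phi> (h # hs) = \<Phi> ((\<lambda>x. \<phi> x * h x) # hs) + dual_azero \<phi> (\<lambda>ks. \<Phi> (h # ks)) hs"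

fun dual_aminus1 :: "(('x \<Rightarrow> real) \<Rightarrow> real) \<Rightarrow> ('x \<Rightarrow> real) \<Rightarrow> (('x \<Rightarrow> real) list \<Rightarrow> real) \<Rightarrow> ('x \<Rightarrow> real) list \<Rightarrow> real" where
  "dual_aminus1 I \<phi> \<Phi> [] = 0"
| "dual_aminus1 I \<phi> \<Phi> (h # hs) = I (\<lambda>x. \<phi> x * h x) * \<Phi> hs + dual_aminus1 I \<phi> (\<lambda>ks. \<Phi> (h # ks)) hs"

text \<open>Each later entry forms two ordered pairs with the head of the list, hence the factor 2;
  the call of \<open>dual_azero\<close> puts the merged factor in the place of the later
  entry.\<close>

fun dual_aminus2 :: "('x \<Rightarrow> real) \<Rightarrow> (('x \<Rightarrow> real) list \<Rightarrow> real) \<Rightarrow> ('x \<Rightarrow> real) list \<Rightarrow> real" where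
  "dual_aminus2 \<phi> \<Phi> [] = 0"
| "dual_aminus2 \<phi> \<Phi> (h # hs) = 2 * dual_azero (\<lambda>x. \<phi> x * h x) \<Phi> hs + dual_aminus2 \<phi> (\<lambda>ks. \<Phi> (h # ks)) hs"

lemma dual_azero_add: "dual_azero \<phi> (\<lambda>ks. \<Phi> ks + \<Psi> ks) hs = dual_azero \<phi> \<Phi> hs + dual_azero \<phi> \<Psi> hs"
  by (induction hs arbitrary: \<Phi> \<Psi>) simp_all

lemma dual_azero_scale: "dual_azero \<phi> (\<lambda>ks. a * \<Phi> ks) hs = a * dual_azero \<phi> \<Phi> hs"
  by (induction hs arbitrary: \<Phi>) (simp_all add: distrib_left)

lemma dual_aminus1_add: "dual_aminus1 I \<phi> (\<lambda>ks. \<Phi> ks + \<Psi> ks) hs = dual_aminus1 I \<phi> \<Phi> hs + dual_aminus1 I \<phi> \<Psi> hs"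
  by (induction hs arbitrary: \<Phi> \<Psi>) (simp_all add: distrib_left)

lemma dual_aminus1_scale: "dual_aminus1 I \<phi> (\<lambda>ks. a * \<Phi> ks) hs = a * dual_aminus1 I \<phi> \<Phi> hs"
  by (induction hs arbitrary: \<Phi>) (simp_all add: distrib_left)

lemma dual_aminus2_add: "dual_aminus2 \<phi> (\<lambda>ks. \<Phi> ks + \<Psi> ks) hs = dual_aminus2 \<phi> \<Phi> hs + dual_aminus2 \<phi> \<Psi> hs"
  by (induction hs arbitrary: \<Phi> \<Psi>) (simp_all add: dual_azero_add)

lemma dual_aminus2_scale: "dual_aminus2 \<phi> (\<lambda>ks. a * \<Phi> ks) hs = a * dual_aminus2 \<phi> \<Phi> hs"
  by (induction hs arbitrary: \<Phi>) (simp_all add: distrib_left dual_azero_scale)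

lemmas dual_linear = dual_azero_add dual_azero_scale dual_aminus1_add dual_aminus1_scale dual_aminus2_add dual_aminus2_scale

section \<open>Commutation relations of the transposed operators\<close>

lemma dual_azero_dual_azero: "dual_azero f (dual_azero g \<Phi>) hs = dual_azero g (dual_azero f \<Phi>) hs"
  by (induction hs arbitrary: \<Phi>) (simp_all add: dual_linear mult_ac)

text \<open>Transposition reverses products, so this is
  \<open>a1(g) a0(f) = a0(f) a1(g) + a1(g f)\<close>. The last term arises when the annihilated
  factor is the one that \<open>f\<close> has multiplied.\<close>

lemma dual_azero_dual_aminus1:
  "dual_azero f (dual_aminus1 I g \<Phi>) hs = dual_aminus1 I g (dual_azero f \<Phi>) hs + dual_aminus1 I (\<lambda>x. g x * f x) \<Phi> hs"
  by (induction hs arbitrary: \<Phi>) (simp_all add: dual_linear mult.assoc mult.left_commute[of "f _"])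

text \<open>There are two ways to multiply a factor of a pair by \<open>f\<close> before merging.
  One is matched by multiplying the merged factor afterwards, the other gives the last term.\<close>

lemma dual_azero_dual_aminus2:
  "dual_azero f (dual_aminus2 g \<Phi>) hs = dual_aminus2 g (dual_azero f \<Phi>) hs + dual_aminus2 (\<lambda>x. g x * f x) \<Phi> hs"
proof (induction hs arbitrary: \<Phi>)
  case (Cons h hs)
  then show ?case
    using dual_azero_dual_azero[of f "\<lambda>x. g x * h x" \<Phi> hs] by (simp add: dual_linear mult_ac)
qed simp

lemma dual_aminus1_dual_aminus1: "dual_aminus1 I f (dual_aminus1 I g \<Phi>) hs = dual_aminus1 I g (dual_aminus1 I f \<Phi>) hs"
  by (induction hs arbitrary: \<Phi>) (simp_all add: dual_linear)

text \<open>Annihilating a factor that has just been merged gives terms with \<open>I\<close> of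
  \<open>f g h_i h_j\<close>. They are symmetric in \<open>f\<close> and \<open>g\<close>, so they
  drop out of the symmetric combination, though not of either commutator alone.\<close>

lemma dual_aminus2_dual_aminus1:
  "dual_aminus2 f (dual_aminus1 I g \<Phi>) hs + dual_aminus1 I f (dual_aminus2 g \<Phi>) hs
   = dual_aminus2 g (dual_aminus1 I f \<Phi>) hs + dual_aminus1 I g (dual_aminus2 f \<Phi>) hs"
proof (induction hs arbitrary: \<Phi>)
  case (Cons h hs)
  show ?case
    using Cons[of "\<lambda>ks. \<Phi> (h # ks)"] dual_azero_dual_aminus1[of "\<lambda>x. f x * h x" I g \<Phi> hs] dual_azero_dual_aminus1[of "\<lambda>x. g x * h x" I f \<Phi> hs]
    by (simp add: dual_linear mult.left_commute[of "f _"])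
qed simp

lemma dual_aminus2_dual_aminus2: "dual_aminus2 f (dual_aminus2 g \<Phi>) hs = dual_aminus2 g (dual_aminus2 f \<Phi>) hs"
proof (induction hs arbitrary: \<Phi>)
  case (Cons h hs)
  show ?case
    using Cons[of "\<lambda>ks. \<Phi> (h # ks)"] dual_azero_dual_aminus2[of "\<lambda>x. f x * h x" g \<Phi> hs] dual_azero_dual_aminus2[of "\<lambda>x. g x * h x" f \<Phi> hs]
    by (simp add: dual_linear mult_ac)
qed simp

section \<open>The transposes of R and D and their commutator\<close>

text \<open>The transpose of \<open>Rhat\<close>, with \<open>I\<close> for the Lebesgue integral.
  The coefficients \<open>b\<close> and \<open>c\<close> are free so as to cover every
  \<open>\<kappa>\<close> as well as the limit.\<close>

definition dual_R :: "(('x \<Rightarrow> real) \<Rightarrow> real) \<Rightarrow> real \<Rightarrow> real \<Rightarrow> real \<Rightarrow> ('x \<Rightarrow> real) \<Rightarrow> (('x \<Rightarrow> real) list \<Rightarrow> real) \<Rightarrow> ('x \<Rightarrow> real) list \<Rightarrow> real" where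
  "dual_R I \<eta> b c \<phi> \<Phi> = (\<lambda>hs. \<Phi> (\<phi> # hs) + b * dual_azero \<phi> \<Phi> hs + dual_aminus1 I \<phi> \<Phi> hs + \<eta> * dual_aminus2 \<phi> \<Phi> hs + c * I \<phi> * \<Phi> hs)"

definition dual_D :: "(('x \<Rightarrow> real) \<Rightarrow> real) \<Rightarrow> real \<Rightarrow> ('x \<Rightarrow> real) \<Rightarrow> (('x \<Rightarrow> real) list \<Rightarrow> real) \<Rightarrow> ('x \<Rightarrow> real) list \<Rightarrow> real" where
  "dual_D I s \<phi> \<Phi> = (\<lambda>hs. s * dual_azero \<phi> \<Phi> hs + dual_aminus1 I \<phi> \<Phi> hs + s\<^sup>2 * dual_aminus2 \<phi> \<Phi> hs)"

lemma dual_R_linear: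
  "dual_R I \<eta> b c \<phi> (\<lambda>ks. \<Phi> ks + a * \<Psi> ks) = (\<lambda>hs. dual_R I \<eta> b c \<phi> \<Phi> hs + a * dual_R I \<eta> b c \<phi> \<Psi> hs)"
  by (simp add: dual_R_def dual_linear fun_eq_iff algebra_simps)

lemma fold_dual_R_linear:
  "fold (dual_R I \<eta> b c) fs (\<lambda>ks. \<Phi> ks + a * \<Psi> ks)
   = (\<lambda>hs. fold (dual_R I \<eta> b c) fs \<Phi> hs + a * fold (dual_R I \<eta> b c) fs \<Psi> hs)"
  by (induction fs arbitrary: \<Phi> \<Psi>) (simp_all add: dual_R_linear)

text \<open>Compare the terms of \<open>[D(g), R(f)]\<close>. The commutators with
  \<open>a+(f)\<close> give \<open>s a+(g f)\<close>, the constant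
  \<open>I(g f) = s c I(g f)\<close> and \<open>2 s^2 a0(g f)\<close>. In the \<open>a1\<close> part
  \<open>-s\<close> from \<open>a0(g)\<close> and \<open>2 s\<close> from \<open>a0(f)\<close> add
  up to \<open>s\<close>; in the \<open>a2\<close> part likewise \<open>-s^3 + 2 s^3 = s^3\<close>.
  This forces the coefficient \<open>2 * s\<close> and the relation
  \<open>s * c = 1\<close>.\<close>

lemma dual_R_dual_D:
  assumes "s * c = 1"
  shows "dual_R I (s\<^sup>2) (2 * s) c f (dual_D I s g \<Phi>)
   = (\<lambda>hs. dual_D I s g (dual_R I (s\<^sup>2) (2 * s) c f \<Phi>) hs + s * dual_R I (s\<^sup>2) (2 * s) c (\<lambda>x. g x * f x) \<Phi> hs)"
proof
  fix hs
  have sc: "s * (c * y) = y" for y using assms by (simp flip: mult.assoc)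
  have A0: "dual_aminus1 I f (dual_azero g \<Phi>) hs = dual_azero g (dual_aminus1 I f \<Phi>) hs - dual_aminus1 I (\<lambda>x. f x * g x) \<Phi> hs"
    using dual_azero_dual_aminus1[of g I f \<Phi> hs] by simp
  have B0: "dual_aminus2 f (dual_azero g \<Phi>) hs = dual_azero g (dual_aminus2 f \<Phi>) hs - dual_aminus2 (\<lambda>x. f x * g x) \<Phi> hs"
    using dual_azero_dual_aminus2[of g f \<Phi> hs] by simp
  have AB: "dual_aminus2 f (dual_aminus1 I g \<Phi>) hs
     = dual_aminus2 g (dual_aminus1 I f \<Phi>) hs + dual_aminus1 I g (dual_aminus2 f \<Phi>) hs - dual_aminus1 I f (dual_aminus2 g \<Phi>) hs"
    using dual_aminus2_dual_aminus1[of f I g \<Phi> hs] by simp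
  have cs: "c * s = 1" using assms by (simp add: mult.commute)
  show "dual_R I (s\<^sup>2) (2 * s) c f (dual_D I s g \<Phi>) hs
   = dual_D I s g (dual_R I (s\<^sup>2) (2 * s) c f \<Phi>) hs + s * dual_R I (s\<^sup>2) (2 * s) c (\<lambda>x. g x * f x) \<Phi> hs"
    by (simp add: dual_R_def dual_D_def dual_linear B0 AB dual_azero_dual_azero[of f g] dual_azero_dual_aminus1[of f I g] A0 dual_azero_dual_aminus2[of f g]
        dual_aminus1_dual_aminus1[of I f g] dual_aminus2_dual_aminus2[of f g] cs sc algebra_simps power2_eq_square)
qed

text \<open>Leibniz rule: when \<open>D(g)\<close> passes a product of operators
  \<open>R(f_i)\<close>, each \<open>f_i\<close> in turn becomes \<open>g f_i\<close>. This sum over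
  the list of operators is again an instance of \<open>dual_azero\<close>.\<close>

lemma fold_dual_R_dual_D:
  fixes I :: "('x \<Rightarrow> real) \<Rightarrow> real"
  assumes "s \<noteq> 0"
  defines "W \<equiv> fold (dual_R I (s\<^sup>2) (2 * s) (1 / s))"
  shows "W fs (dual_D I s g \<Phi>) hs = dual_D I s g (W fs \<Phi>) hs + s * dual_azero g (\<lambda>ks. W ks \<Phi> hs) fs"
proof (induction fs arbitrary: \<Phi>)
  case (Cons f fs)
  show ?case
    using Cons[of "dual_R I (s\<^sup>2) (2 * s) (1 / s) f \<Phi>"] unfolding W_def
    by (simp add: dual_R_dual_D assms(1) fold_dual_R_linear distrib_left)
qed (simp add: W_def)

text \<open>The functional taking a Fock vector to its degree-zero component, evaluated on symmetric
  tensors.\<close>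

definition vac_functional :: "'a list \<Rightarrow> real" where
  "vac_functional hs = (if hs = [] then 1 else 0)"

lemma dual_azero_vanish: "dual_azero g (\<lambda>ks. if ks = [] then a else 0) hs = 0" 
  \<comment> \<open>The scaling rule with scalar 0 says that the transpose of the zero functional is
    zero.\<close>
  by (cases hs) (simp_all add: dual_azero_scale[of g 0 "\<lambda>_. 0", simplified])

lemma dual_aminus2_vanish: "dual_aminus2 g (\<lambda>ks. if ks = [] then a else 0) hs = 0"
  by (cases hs) (simp_all add: dual_aminus2_scale[of g 0 "\<lambda>_. 0", simplified] dual_azero_vanish)

text \<open>Only \<open>a1\<close> and the constant term reach degree zero: the images of
  \<open>a+\<close>, \<open>a0\<close> and \<open>a2\<close> have degree at least one.\<close>

lemma dual_R_vac:
  "dual_R I (s\<^sup>2) b c g vac_functional = (\<lambda>hs. dual_D I s g vac_functional hs + (c * I g) * vac_functional hs)"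
  by (simp add: dual_R_def dual_D_def vac_functional_def[abs_def] dual_azero_vanish dual_aminus2_vanish fun_eq_iff)

text \<open>\<open>R(g)\<close> is the leftmost factor, so under the vacuum component it may be
  replaced by \<open>D(g)\<close> plus a constant; \<open>D(g)\<close> then moves to the right until
  it meets the vacuum.\<close>

lemma vac_moment_Cons:
  fixes I :: "('x \<Rightarrow> real) \<Rightarrow> real"
  assumes "s \<noteq> 0"
  defines "M \<equiv> \<lambda>fs. fold (dual_R I (s\<^sup>2) (2 * s) (1 / s)) fs vac_functional []"
  shows "M (g # fs) = I g / s * M fs + s * dual_azero g M fs"
proof -
  define W where "W = fold (dual_R I (s\<^sup>2) (2 * s) (1 / s))"
  have "M (g # fs) = W fs (\<lambda>hs. dual_D I s g vac_functional hs + (1 / s * I g) * vac_functional hs) []"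
    unfolding M_def W_def by (simp only: fold_Cons o_apply dual_R_vac)
  also have "\<dots> = W fs (dual_D I s g vac_functional) [] + (1 / s * I g) * M fs"
    unfolding M_def W_def by (simp only: fold_dual_R_linear)
  also have "W fs (dual_D I s g vac_functional) [] = dual_D I s g (W fs vac_functional) [] + s * dual_azero g (\<lambda>ks. W ks vac_functional []) fs"
    unfolding W_def by (rule fold_dual_R_dual_D[OF assms(1)])
  \<comment> \<open>\<open>dual_D\<close> vanishes at the empty list, because \<open>D(g)\<close>
    annihilates the vacuum.\<close>
  also have "\<dots> = s * dual_azero g M fs"
    by (simp add: dual_D_def M_def W_def)
  finally show ?thesis by simp
qed

section \<open>Products of density operators applied to the vacuum\<close>

lemma Ck_continuous: "Ck k f \<Longrightarrow> continuous_on UNIV f"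
  by (cases k) (simp_all add: differentiable_imp_continuous_on differentiable_on_def)

lemma Ck_SucD: "Ck (Suc k) f \<Longrightarrow> Ck k f"
proof (induction k arbitrary: f)
  case 0
  then show ?case using Ck_continuous[of "Suc 0" f] by simp
next
  case (Suc k)
  then show ?case by (subst Ck.simps, subst (asm) (2) Ck.simps) blast
qed

lemma Ck_add: "Ck k f \<Longrightarrow> Ck k g \<Longrightarrow> Ck k (\<lambda>x. f x + g x)"
proof (induction k arbitrary: f g)
  case 0
  then show ?case by (auto intro: continuous_intros)
next
  case (Suc k)
  have "frechet_derivative (\<lambda>x. f x + g x) (at x) = (\<lambda>v. frechet_derivative f (at x) v + frechet_derivative g (at x) v)" for x
    using Suc.prems by (intro frechet_derivative_at[symmetric] has_derivative_add)
      (auto simp: frechet_derivative_works[symmetric])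
  then show ?case using Suc by (auto intro: differentiable_add)
qed

lemma Ck_mult: "Ck k f \<Longrightarrow> Ck k g \<Longrightarrow> Ck k (\<lambda>x. f x * g x)"
proof (induction k arbitrary: f g)
  case 0
  then show ?case by (auto intro: continuous_intros)
next
  case (Suc k)
  have "frechet_derivative (\<lambda>x. f x * g x) (at x)
      = (\<lambda>v. f x * frechet_derivative g (at x) v + frechet_derivative f (at x) v * g x)" for x
    using Suc.prems by (intro frechet_derivative_at[symmetric] has_derivative_mult)
      (auto simp: frechet_derivative_works[symmetric])
  then show ?case using Suc.prems Suc.IH Ck_SucD[OF Suc.prems(1)] Ck_SucD[OF Suc.prems(2)]
    by (auto intro!: differentiable_mult Ck_add)
qed

lemma compactly_supported_subset:
  assumes "compactly_supported f" "\<And>x. f x = 0 \<Longrightarrow> g x = 0"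
  shows "compactly_supported g"
proof -
  have "closure {x. g x \<noteq> 0} \<subseteq> closure {x. f x \<noteq> 0}"
    using assms(2) by (intro closure_mono) auto
  moreover have "compact (closure {x. f x \<noteq> 0})"
    using assms(1) by (simp add: compactly_supported_def)
  ultimately show ?thesis
    unfolding compactly_supported_def
    using compact_Int_closed[of "closure {x. f x \<noteq> 0}" "closure {x. g x \<noteq> 0}"] by (simp add: Int_absorb1)
qed

lemma test_functions_mult:
  "f \<in> test_functions \<Longrightarrow> g \<in> test_functions \<Longrightarrow> (\<lambda>x. f x * g x) \<in> test_functions"
  by (auto simp: test_functions_def intro: Ck_mult compactly_supported_subset[of f])

lemma test_functions_C0: "f \<in> test_functions \<Longrightarrow> f \<in> C0"
  by (auto simp: test_functions_def C0_def intro: Ck_continuous)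

section \<open>Invariance of the Fock space under the operators\<close>

lemma is_lin_extD:
  assumes "is_lin_ext n g A"
  shows "u \<in> sym_power n \<Longrightarrow> v \<in> sym_power n \<Longrightarrow> A (\<lambda>xs. u xs + v xs) = (\<lambda>xs. A u xs + A v xs)"
    and "u \<in> sym_power n \<Longrightarrow> A (\<lambda>xs. c * u xs) = (\<lambda>xs. c * A u xs)"
    and "length fs = n \<Longrightarrow> set fs \<subseteq> test_functions \<Longrightarrow> A (sym_tensor fs) = g fs"
  using assms by (auto simp: is_lin_ext_def)

lemma is_lin_ext_zero:
  assumes "is_lin_ext n g A" shows "A (\<lambda>_. 0) = (\<lambda>_. 0)"
  using is_lin_extD(2)[OF assms sym_power_zero, of 0] by simp

lemma is_lin_ext_in:
  assumes "is_lin_ext n g A" and "u \<in> sym_power n"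
    and "\<And>fs. length fs = n \<Longrightarrow> set fs \<subseteq> test_functions \<Longrightarrow> g fs \<in> sym_power m"
  shows "A u \<in> sym_power m"
  using assms(2)
proof (induction rule: sym_power_induct)
  case zero
  then show ?case by (simp add: is_lin_ext_zero[OF assms(1)] sym_power_zero)
next
  case (add c fs v)
  then show ?case
    using assms(3)[of fs]
    by (simp add: is_lin_extD[OF assms(1)] sym_tensor_in sym_power_scale sym_power_add)
qed

lemma sym_power_sum:
  "(\<And>i. i \<in> S \<Longrightarrow> u i \<in> sym_power n) \<Longrightarrow> (\<lambda>xs. \<Sum>i\<in>S. c i * u i xs) \<in> sym_power n"
  by (induction S rule: infinite_finite_induct)
    (simp_all add: sym_power_zero sym_power_add sym_power_scale)

lemma sym_power_sum':
  "(\<And>i. i \<in> S \<Longrightarrow> u i \<in> sym_power n) \<Longrightarrow> (\<lambda>xs. \<Sum>i\<in>S. u i xs) \<in> sym_power n"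
  using sym_power_sum[of S u n "\<lambda>_. 1"] by simp

lemma nth_test_function: "set fs \<subseteq> test_functions \<Longrightarrow> i < length fs \<Longrightarrow> fs ! i \<in> test_functions"
  using nth_mem by blast

lemma length_remove_two:
  assumes "i < length fs" "j < length fs" "i \<noteq> j"
  shows "Suc (Suc (length (nths fs (- {i, j})))) = length fs"
  using arg_cong[OF mset_remove_two[OF assms], of size] by simp

lemma set_update_test:
  assumes "\<phi> \<in> test_functions" "set fs \<subseteq> test_functions" "i < length fs"
  shows "set (fs[i := (\<lambda>x. \<phi> x * (fs ! i) x)]) \<subseteq> test_functions"
  using set_update_subset_insert[of fs i] assms by (blast intro: test_functions_mult nth_test_function)

lemma set_merge_test:
  assumes "\<phi> \<in> test_functions" "set fs \<subseteq> test_functions" "i < length fs" "j < length fs"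
  shows "set ((\<lambda>x. \<phi> x * (fs ! i) x * (fs ! j) x) # nths fs A) \<subseteq> test_functions"
  using assms set_nths_subset[of fs A] by (auto intro!: test_functions_mult nth_test_function)

lemma set_nths_test: "set fs \<subseteq> test_functions \<Longrightarrow> set (nths fs A) \<subseteq> test_functions"
  using set_nths_subset[of fs A] by blast

lemma aplus_in:
  "\<phi> \<in> test_functions \<Longrightarrow> u \<in> sym_power n \<Longrightarrow> aplus \<phi> n u \<in> sym_power (Suc n)"
  by (rule is_lin_ext_in[OF is_lin_ext_aplus]) (simp_all add: sym_tensor_in)

lemma azero_in:
  assumes "\<phi> \<in> test_functions" "u \<in> sym_power n" shows "azero \<phi> n u \<in> sym_power n"
proof (rule is_lin_ext_in[OF is_lin_ext_azero assms(2)])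
  show "(\<lambda>xs. \<Sum>i<n. sym_tensor (fs[i := (\<lambda>x. \<phi> x * (fs ! i) x)]) xs) \<in> sym_power n"
    if "length fs = n" "set fs \<subseteq> test_functions" for fs
    using that assms(1) by (intro sym_power_sum' sym_tensor_in set_update_test) auto
qed

lemma aminus1_in:
  assumes "\<phi> \<in> test_functions" "u \<in> sym_power (Suc n)" shows "aminus1 \<phi> (Suc n) u \<in> sym_power n"
proof (rule is_lin_ext_in[OF is_lin_ext_aminus1 assms(2)])
  show "(\<lambda>xs. \<Sum>i<Suc n. (\<integral>x. \<phi> x * (fs ! i) x \<partial>lborel) * sym_tensor (nths fs (- {i})) xs) \<in> sym_power n"
    if "length fs = Suc n" "set fs \<subseteq> test_functions" for fs
    using that length_remove_nth[of _ fs] by (intro sym_power_sum sym_tensor_in set_nths_test) auto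
qed (fact assms)

lemma aminus2_in:
  assumes "\<phi> \<in> test_functions" "u \<in> sym_power (Suc n)" shows "aminus2 \<phi> (Suc n) u \<in> sym_power n"
proof (rule is_lin_ext_in[OF is_lin_ext_aminus2 assms(2)])
  show "(\<lambda>xs. \<Sum>i<Suc n. \<Sum>j\<in>{..<Suc n} - {i}. sym_tensor ((\<lambda>x. \<phi> x * (fs ! i) x * (fs ! j) x) # nths fs (- {i, j})) xs) \<in> sym_power n"
    if "length fs = Suc n" "set fs \<subseteq> test_functions" for fs
    using that length_remove_two[of _ fs] assms(1) by (intro sym_power_sum' sym_tensor_in set_merge_test) auto
qed

lemma Ffin_add: assumes "F \<in> Ffin" "G \<in> Ffin" shows "(\<lambda>n xs. F n xs + G n xs) \<in> Ffin"
proof -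
  obtain N M where "\<forall>n>N. F n = (\<lambda>_. 0)" "\<forall>n>M. G n = (\<lambda>_. 0)"
    using assms by (auto simp: Ffin_def)
  then have "\<forall>n>max N M. (\<lambda>xs. F n xs + G n xs) = (\<lambda>_. 0)" by simp
  then show ?thesis
    using assms unfolding Ffin_def by (blast intro: sym_power_add)
qed

lemma Ffin_scale: assumes "F \<in> Ffin" shows "(\<lambda>n xs. c * F n xs) \<in> Ffin"
proof -
  obtain N where "\<forall>n>N. F n = (\<lambda>_. 0)"
    using assms by (auto simp: Ffin_def)
  then have "\<forall>n>N. (\<lambda>xs. c * F n xs) = (\<lambda>_. 0)" by simp
  then show ?thesis
    using assms unfolding Ffin_def by (blast intro: sym_power_scale)
qed

lemma Ffin_zero: "(\<lambda>n xs. 0) \<in> Ffin"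
  unfolding Ffin_def by (auto intro: sym_power_zero)

lemma Ffin_sum: "(\<And>i. i \<in> S \<Longrightarrow> V i \<in> Ffin) \<Longrightarrow> (\<lambda>n xs. \<Sum>i\<in>S. c i * V i n xs) \<in> Ffin"
  by (induction S rule: infinite_finite_induct) (simp_all add: Ffin_zero Ffin_add Ffin_scale)

lemma FfinD: "F \<in> Ffin \<Longrightarrow> F n \<in> sym_power n"
  by (simp add: Ffin_def)

lemma Rhat_in:
  assumes "\<phi> \<in> test_functions" "F \<in> Ffin" shows "Rhat \<eta> \<kappa> \<phi> F \<in> Ffin"
proof -
  obtain N where N: "\<forall>n>N. F n = (\<lambda>_. 0)" using assms by (auto simp: Ffin_def)
  have "Rhat \<eta> \<kappa> \<phi> F n \<in> sym_power n" for n
  proof -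
    have "(\<lambda>xs. if n = 0 then 0 else aplus \<phi> (n - 1) (F (n - 1)) xs) \<in> sym_power n"
      using aplus_in[OF assms(1) FfinD[OF assms(2)], of "n - 1"] by (cases n) (auto intro: sym_power_zero)
    then show ?thesis
      using assms FfinD[OF assms(2)]
      unfolding Rhat_def
      by (simp add: sym_power_add sym_power_scale azero_in aminus1_in aminus2_in)
  qed
  \<comment> \<open>Creation raises the degree by one, so the last non-zero degree may grow from
    \<open>N\<close> to \<open>Suc N\<close>.\<close>
  moreover have "Rhat \<eta> \<kappa> \<phi> F n = (\<lambda>_. 0)" if "n > Suc N" for n
  proof -
    have "F n = (\<lambda>_. 0)" "F (n - 1) = (\<lambda>_. 0)" "F (Suc n) = (\<lambda>_. 0)" using N that by auto
    then show ?thesis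
      using assms that unfolding Rhat_def
      by (simp add: is_lin_ext_zero[OF is_lin_ext_aplus] is_lin_ext_zero[OF is_lin_ext_azero]
          is_lin_ext_zero[OF is_lin_ext_aminus1[OF assms(1)]] is_lin_ext_zero[OF is_lin_ext_aminus2])
  qed
  ultimately show ?thesis unfolding Ffin_def by blast
qed

lemma Rhat_add:
  assumes "\<phi> \<in> test_functions" "F \<in> Ffin" "G \<in> Ffin"
  shows "Rhat \<eta> \<kappa> \<phi> (\<lambda>n xs. F n xs + G n xs) = (\<lambda>n xs. Rhat \<eta> \<kappa> \<phi> F n xs + Rhat \<eta> \<kappa> \<phi> G n xs)"
  using assms
  by (simp add: Rhat_def Ffin_add FfinD[OF assms(2)] FfinD[OF assms(3)] is_lin_extD(1)[OF is_lin_ext_aplus] is_lin_extD(1)[OF is_lin_ext_azero]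
      is_lin_extD(1)[OF is_lin_ext_aminus1[OF assms(1)]] is_lin_extD(1)[OF is_lin_ext_aminus2] fun_eq_iff algebra_simps)

lemma Rhat_scale:
  assumes "\<phi> \<in> test_functions" "F \<in> Ffin"
  shows "Rhat \<eta> \<kappa> \<phi> (\<lambda>n xs. c * F n xs) = (\<lambda>n xs. c * Rhat \<eta> \<kappa> \<phi> F n xs)"
  using assms
  by (simp add: Rhat_def Ffin_scale FfinD[OF assms(2)] is_lin_extD(2)[OF is_lin_ext_aplus] is_lin_extD(2)[OF is_lin_ext_azero]
      is_lin_extD(2)[OF is_lin_ext_aminus1[OF assms(1)]] is_lin_extD(2)[OF is_lin_ext_aminus2] fun_eq_iff algebra_simps)

section \<open>Density operators on symmetric tensors\<close>

definition tensor_vec :: "(real ^ 'd \<Rightarrow> real) list \<Rightarrow> (real ^ 'd) fock" where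
  "tensor_vec hs n = (if n = length hs then sym_tensor hs else (\<lambda>_. 0))"

lemma tensor_vec_in: "set hs \<subseteq> test_functions \<Longrightarrow> tensor_vec hs \<in> Ffin"
  unfolding Ffin_def tensor_vec_def by (auto intro: sym_tensor_in sym_power_zero)

lemma vac_eq: "vac = tensor_vec []"
  by (simp add: vac_def tensor_vec_def fun_eq_iff)

lemma tensor_vec_mset: "mset fs = mset gs \<Longrightarrow> tensor_vec fs = tensor_vec gs"
  using sym_tensor_mset[of fs gs] mset_eq_length[of fs gs] by (auto simp: tensor_vec_def fun_eq_iff)

lemma Rhat_tensor_vec:
  assumes "\<phi> \<in> test_functions" "set hs \<subseteq> test_functions"
  defines "m \<equiv> length hs"
  shows "Rhat \<eta> \<kappa> \<phi> (tensor_vec hs) = (\<lambda>n xs. tensor_vec (\<phi> # hs) n xs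
     + (beta \<eta> \<kappa> + inverse (beta \<eta> \<kappa>) * \<eta>) * (\<Sum>i<m. tensor_vec (hs[i := (\<lambda>x. \<phi> x * (hs ! i) x)]) n xs)
     + (\<Sum>i<m. (\<integral>x. \<phi> x * (hs ! i) x \<partial>lborel) * tensor_vec (nths hs (- {i})) n xs)
     + \<eta> * (\<Sum>i<m. \<Sum>j\<in>{..<m} - {i}. tensor_vec ((\<lambda>x. \<phi> x * (hs ! i) x * (hs ! j) x) # nths hs (- {i, j})) n xs)
     + inverse (beta \<eta> \<kappa>) * (\<integral>x. \<phi> x \<partial>lborel) * tensor_vec hs n xs)"
proof (intro ext)
  fix n xs
  have 1: "(if n = 0 then 0 else aplus \<phi> (n - 1) (tensor_vec hs (n - 1)) xs) = tensor_vec (\<phi> # hs) n xs"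
    using assms is_lin_extD(3)[OF is_lin_ext_aplus, of hs _ \<phi>]
    by (cases n) (auto simp: tensor_vec_def is_lin_ext_zero[OF is_lin_ext_aplus])
  have 2: "azero \<phi> n (tensor_vec hs n) xs = (\<Sum>i<m. tensor_vec (hs[i := (\<lambda>x. \<phi> x * (hs ! i) x)]) n xs)"
    using assms is_lin_extD(3)[OF is_lin_ext_azero, of hs _ \<phi>]
    by (auto simp: tensor_vec_def is_lin_ext_zero[OF is_lin_ext_azero])
  have 3: "aminus1 \<phi> (n + 1) (tensor_vec hs (n + 1)) xs = (\<Sum>i<m. (\<integral>x. \<phi> x * (hs ! i) x \<partial>lborel) * tensor_vec (nths hs (- {i})) n xs)"
  proof -
    have "n = length (nths hs (- {i})) \<longleftrightarrow> Suc n = m" if "i < m" for i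
      using length_remove_nth[of i hs] that by (auto simp: m_def)
    then show ?thesis
      using assms is_lin_extD(3)[OF is_lin_ext_aminus1[OF assms(1)], of hs]
      by (auto simp: tensor_vec_def is_lin_ext_zero[OF is_lin_ext_aminus1[OF assms(1)]] m_def)
  qed
  have 4: "aminus2 \<phi> (n + 1) (tensor_vec hs (n + 1)) xs
     = (\<Sum>i<m. \<Sum>j\<in>{..<m} - {i}. tensor_vec ((\<lambda>x. \<phi> x * (hs ! i) x * (hs ! j) x) # nths hs (- {i, j})) n xs)"
  proof -
    have "n = Suc (length (nths hs (- {i, j}))) \<longleftrightarrow> Suc n = m" if "i < m" "j < m" "j \<noteq> i" for i j
      using length_remove_two[of i hs j] that by (auto simp: m_def)
    then show ?thesis
      using assms is_lin_extD(3)[OF is_lin_ext_aminus2, of hs _ \<phi>]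
      by (auto simp: tensor_vec_def is_lin_ext_zero[OF is_lin_ext_aminus2] m_def)
  qed
  show "Rhat \<eta> \<kappa> \<phi> (tensor_vec hs) n xs = tensor_vec (\<phi> # hs) n xs
     + (beta \<eta> \<kappa> + inverse (beta \<eta> \<kappa>) * \<eta>) * (\<Sum>i<m. tensor_vec (hs[i := (\<lambda>x. \<phi> x * (hs ! i) x)]) n xs)
     + (\<Sum>i<m. (\<integral>x. \<phi> x * (hs ! i) x \<partial>lborel) * tensor_vec (nths hs (- {i})) n xs)
     + \<eta> * (\<Sum>i<m. \<Sum>j\<in>{..<m} - {i}. tensor_vec ((\<lambda>x. \<phi> x * (hs ! i) x * (hs ! j) x) # nths hs (- {i, j})) n xs)
     + inverse (beta \<eta> \<kappa>) * (\<integral>x. \<phi> x \<partial>lborel) * tensor_vec hs n xs"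
    unfolding 1[symmetric] 2[symmetric] 3[symmetric] 4[symmetric]
    using tensor_vec_in[OF assms(2)] by (simp add: Rhat_def)
qed


section \<open>Closed forms of the transposed operators\<close>

lemma dual_azero_sum: "dual_azero \<phi> \<Phi> hs = (\<Sum>i<length hs. \<Phi> (hs[i := (\<lambda>x. \<phi> x * (hs ! i) x)]))"
  by (induction hs arbitrary: \<Phi>) (simp_all add: sum.lessThan_Suc_shift del: sum.lessThan_Suc)

lemma nths_Cons_0: "nths (h # hs) (- {0}) = hs"
  by (simp add: nths_Cons nths_all)

lemma nths_Cons_Suc: "nths (h # hs) (- {Suc i}) = h # nths hs (- {i})"
  by (simp add: nths_Cons Compl_eq)

lemma dual_aminus1_sum: "dual_aminus1 I \<phi> \<Phi> hs = (\<Sum>i<length hs. I (\<lambda>x. \<phi> x * (hs ! i) x) * \<Phi> (nths hs (- {i})))"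
  by (induction hs arbitrary: \<Phi>)
    (simp_all add: sum.lessThan_Suc_shift nths_Cons_0 nths_Cons_Suc del: sum.lessThan_Suc)

lemma sum_remove_if: "(\<Sum>j\<in>{..<n::nat} - {i}. G j) = (\<Sum>j<n. if j = i then 0 else G j :: real)"
  by (rule sum.mono_neutral_cong_left) auto

lemma mset_update_remove:
  assumes "i < length hs" shows "mset (hs[i := h]) = mset (h # nths hs (- {i}))"
  using mset_update[OF assms, of h] mset_remove_nth[OF assms] by simp

text \<open>In the recursion the merged factor replaces the later entry of the pair, in the
  definition of \<open>aminus2\<close> it heads the list. A functional that depends only on the
  multiset of entries does not see the difference.\<close>

lemma dual_aminus2_sum:
  assumes "\<And>ks ks'. mset ks = mset ks' \<Longrightarrow> \<Phi> ks = \<Phi> ks'"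
  shows "dual_aminus2 \<phi> \<Phi> hs = (\<Sum>i<length hs. \<Sum>j\<in>{..<length hs} - {i}.
    \<Phi> ((\<lambda>x. \<phi> x * (hs ! i) x * (hs ! j) x) # nths hs (- {i, j})))"
  using assms
proof (induction hs arbitrary: \<Phi>)
  case (Cons h hs)
  have z: "dual_azero (\<lambda>x. \<phi> x * h x) \<Phi> hs
     = (\<Sum>j<length hs. \<Phi> ((\<lambda>x. \<phi> x * h x * (hs ! j) x) # nths hs (- {j})))"
    unfolding dual_azero_sum by (intro sum.cong refl Cons.prems mset_update_remove) simp
  have s: "\<Phi> (p # h # nths hs A) = \<Phi> (h # p # nths hs A)" for p A
    by (rule Cons.prems) simp
  have n1: "nths (h # hs) (- {0, Suc j}) = nths hs (- {j})" "nths (h # hs) (- {Suc j, 0}) = nths hs (- {j})" for j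
    by (simp_all add: nths_Cons) (auto intro: arg_cong[where f="nths hs"])
  have n2: "nths (h # hs) (- {Suc i, Suc j}) = h # nths hs (- {i, j})" for i j
    by (simp add: nths_Cons) (auto intro: arg_cong[where f="nths hs"])
  have "dual_aminus2 \<phi> (\<lambda>ks. \<Phi> (h # ks)) hs = (\<Sum>i<length hs. \<Sum>j\<in>{..<length hs} - {i}.
    \<Phi> (h # (\<lambda>x. \<phi> x * (hs ! i) x * (hs ! j) x) # nths hs (- {i, j})))"
    by (rule Cons.IH) (auto intro: Cons.prems)
  note IH = this
  define G where "G i j = \<Phi> ((\<lambda>x. \<phi> x * ((h # hs) ! i) x * ((h # hs) ! j) x) # nths (h # hs) (- {i, j}))" for i j
  have G: "G 0 (Suc j) = \<Phi> ((\<lambda>x. \<phi> x * h x * (hs ! j) x) # nths hs (- {j}))"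
    "G (Suc j) 0 = \<Phi> ((\<lambda>x. \<phi> x * h x * (hs ! j) x) # nths hs (- {j}))"
    "G (Suc i) (Suc j) = \<Phi> (h # (\<lambda>x. \<phi> x * (hs ! i) x * (hs ! j) x) # nths hs (- {i, j}))" for i j
    unfolding G_def n1 n2 s by (simp_all add: mult_ac)
  \<comment> \<open>The index 0 is split off. The pairs \<open>(0, j)\<close> and
    \<open>(j, 0)\<close> contribute equal sums, which produces the factor 2 of the
    recursion.\<close>
  have "(\<Sum>i<length (h # hs). \<Sum>j\<in>{..<length (h # hs)} - {i}. G i j)
     = (\<Sum>j<length hs. G 0 (Suc j)) + (\<Sum>i<length hs. G (Suc i) 0 + (\<Sum>j\<in>{..<length hs} - {i}. G (Suc i) (Suc j)))"
    by (simp add: sum_remove_if sum.lessThan_Suc_shift del: sum.lessThan_Suc)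
  also have "\<dots> = dual_aminus2 \<phi> \<Phi> (h # hs)"
    unfolding G sum.distrib IH[symmetric] z[symmetric] by simp
  finally show ?case unfolding G_def ..
next
  case Nil
  show ?case by simp
qed

section \<open>Transposition of density operators\<close>

definition fock_linear :: "((real ^ 'd) fock \<Rightarrow> real) \<Rightarrow> bool" where
  "fock_linear \<Psi> \<longleftrightarrow> (\<forall>F\<in>Ffin. \<forall>G\<in>Ffin. \<Psi> (\<lambda>n xs. F n xs + G n xs) = \<Psi> F + \<Psi> G)
     \<and> (\<forall>c. \<forall>F\<in>Ffin. \<Psi> (\<lambda>n xs. c * F n xs) = c * \<Psi> F)"

lemma fock_linear_add: "fock_linear \<Psi> \<Longrightarrow> F \<in> Ffin \<Longrightarrow> G \<in> Ffin \<Longrightarrow> \<Psi> (\<lambda>n xs. F n xs + G n xs) = \<Psi> F + \<Psi> G"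
  and fock_linear_scale: "fock_linear \<Psi> \<Longrightarrow> F \<in> Ffin \<Longrightarrow> \<Psi> (\<lambda>n xs. c * F n xs) = c * \<Psi> F"
  by (auto simp: fock_linear_def)

text \<open>The five summands are those of \<open>Rhat\<close>: creation, neutral, the two
  annihilation parts, and the constant.\<close>

lemma fock_linear_sum5:
  assumes "fock_linear \<Psi>" "F1 \<in> Ffin" "F2 \<in> Ffin" "F3 \<in> Ffin" "F4 \<in> Ffin" "F5 \<in> Ffin"
  shows "\<Psi> (\<lambda>n xs. F1 n xs + b * F2 n xs + F3 n xs + d * F4 n xs + e * F5 n xs)
    = \<Psi> F1 + b * \<Psi> F2 + \<Psi> F3 + d * \<Psi> F4 + e * \<Psi> F5"
  using assms(2-) by (simp add: fock_linear_add[OF assms(1)] fock_linear_scale[OF assms(1)] Ffin_add Ffin_scale)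

lemma fock_linear_sum:
  assumes "fock_linear \<Psi>" "\<And>i. i \<in> S \<Longrightarrow> V i \<in> Ffin"
  shows "\<Psi> (\<lambda>n xs. \<Sum>i\<in>S. c i * V i n xs) = (\<Sum>i\<in>S. c i * \<Psi> (V i))"
proof -
  have 0: "\<Psi> (\<lambda>n xs. 0) = 0"
    using fock_linear_scale[OF assms(1) Ffin_zero, of 0] by simp
  show ?thesis
    using assms(2)
  proof (induction S rule: infinite_finite_induct)
    case (insert i S)
    then have "\<Psi> (\<lambda>n xs. c i * V i n xs + (\<Sum>i\<in>S. c i * V i n xs)) = \<Psi> (\<lambda>n xs. c i * V i n xs) + \<Psi> (\<lambda>n xs. \<Sum>i\<in>S. c i * V i n xs)"
      by (intro fock_linear_add[OF assms(1)] Ffin_scale Ffin_sum) auto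
    then show ?case using insert by (simp add: fock_linear_scale[OF assms(1)])
  qed (simp_all add: 0)
qed

lemma fock_linear_Rhat:
  assumes "fock_linear \<Psi>" "\<phi> \<in> test_functions"
  shows "fock_linear (\<lambda>F. \<Psi> (Rhat \<eta> \<kappa> \<phi> F))"
  using assms unfolding fock_linear_def by (simp add: Rhat_add Rhat_scale Rhat_in)

abbreviation (input) leb :: "(real ^ 'd \<Rightarrow> real) \<Rightarrow> real" where
  "leb f \<equiv> \<integral>x. f x \<partial>lborel"

text \<open>This justifies the recursions on lists: precomposing a linear functional with
  \<open>Rhat\<close> changes its values on symmetric tensors by \<open>dual_R\<close>.\<close>

lemma functional_Rhat_tensor_vec:
  assumes \<Psi>: "fock_linear \<Psi>" and \<phi>: "\<phi> \<in> test_functions" and hs: "set hs \<subseteq> test_functions"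
  shows "\<Psi> (Rhat \<eta> \<kappa> \<phi> (tensor_vec hs))
    = dual_R leb \<eta> (beta \<eta> \<kappa> + inverse (beta \<eta> \<kappa>) * \<eta>) (inverse (beta \<eta> \<kappa>)) \<phi> (\<lambda>ks. \<Psi> (tensor_vec ks)) hs"
proof -
  let ?m = "length hs"
  let ?b = "beta \<eta> \<kappa> + inverse (beta \<eta> \<kappa>) * \<eta>"
  have F1: "tensor_vec (\<phi> # hs) \<in> Ffin" using \<phi> hs by (intro tensor_vec_in) auto
  have V2: "tensor_vec (hs[i := (\<lambda>x. \<phi> x * (hs ! i) x)]) \<in> Ffin" if "i < ?m" for i
    using that \<phi> hs by (intro tensor_vec_in set_update_test) auto
  have V3: "tensor_vec (nths hs A) \<in> Ffin" for A
    using hs by (intro tensor_vec_in set_nths_test)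
  have V4: "tensor_vec ((\<lambda>x. \<phi> x * (hs ! i) x * (hs ! j) x) # nths hs A) \<in> Ffin" if "i < ?m" "j < ?m" for i j A
    using that \<phi> hs by (intro tensor_vec_in set_merge_test) auto
  \<comment> \<open>The factors 1 give the sums the shape \<open>c i * V i\<close> that
    \<open>Ffin_sum\<close> and \<open>fock_linear_sum\<close> expect.\<close>
  define F2 where "F2 = (\<lambda>n xs. \<Sum>i<?m. 1 * tensor_vec (hs[i := (\<lambda>x. \<phi> x * (hs ! i) x)]) n xs)"
  define F3 where "F3 = (\<lambda>n xs. \<Sum>i<?m. leb (\<lambda>x. \<phi> x * (hs ! i) x) * tensor_vec (nths hs (- {i})) n xs)"
  define F4' where "F4' i = (\<lambda>n xs. \<Sum>j\<in>{..<?m} - {i}. 1 * tensor_vec ((\<lambda>x. \<phi> x * (hs ! i) x * (hs ! j) x) # nths hs (- {i, j})) n xs)" for i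
  define F4 where "F4 = (\<lambda>n xs. \<Sum>i<?m. 1 * F4' i n xs)"
  have F2: "F2 \<in> Ffin" unfolding F2_def using V2 by (intro Ffin_sum) auto
  have F3: "F3 \<in> Ffin" unfolding F3_def using V3 by (intro Ffin_sum) auto
  have F4': "F4' i \<in> Ffin" if "i < ?m" for i unfolding F4'_def using V4 that by (intro Ffin_sum) auto
  have F4: "F4 \<in> Ffin" unfolding F4_def using F4' by (intro Ffin_sum) auto
  note F5 = tensor_vec_in[OF hs]
  have sym: "\<Psi> (tensor_vec ks) = \<Psi> (tensor_vec ks')" if "mset ks = mset ks'" for ks ks'
    using tensor_vec_mset[OF that] by simp
  have t2: "dual_aminus2 \<phi> (\<lambda>ks. \<Psi> (tensor_vec ks)) hs = (\<Sum>i<?m. \<Sum>j\<in>{..<?m} - {i}.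
      \<Psi> (tensor_vec ((\<lambda>x. \<phi> x * (hs ! i) x * (hs ! j) x) # nths hs (- {i, j}))))"
    by (rule dual_aminus2_sum) (rule sym)
  have R: "Rhat \<eta> \<kappa> \<phi> (tensor_vec hs) = (\<lambda>n xs. tensor_vec (\<phi> # hs) n xs + ?b * F2 n xs + F3 n xs + \<eta> * F4 n xs
      + (inverse (beta \<eta> \<kappa>) * leb \<phi>) * tensor_vec hs n xs)"
    using Rhat_tensor_vec[OF \<phi> hs] by (simp add: F2_def F3_def F4_def F4'_def)
  have "\<Psi> (Rhat \<eta> \<kappa> \<phi> (tensor_vec hs)) = \<Psi> (tensor_vec (\<phi> # hs)) + ?b * \<Psi> F2 + \<Psi> F3 + \<eta> * \<Psi> F4 + (inverse (beta \<eta> \<kappa>) * leb \<phi>) * \<Psi> (tensor_vec hs)"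
    unfolding R by (rule fock_linear_sum5[OF \<Psi> F1 F2 F3 F4 F5])
  also have "\<Psi> F2 = dual_azero \<phi> (\<lambda>ks. \<Psi> (tensor_vec ks)) hs"
    unfolding F2_def dual_azero_sum using V2 by (subst fock_linear_sum[OF \<Psi>]) auto
  also have "\<Psi> F3 = dual_aminus1 leb \<phi> (\<lambda>ks. \<Psi> (tensor_vec ks)) hs"
    unfolding F3_def dual_aminus1_sum using V3 by (subst fock_linear_sum[OF \<Psi>]) auto
  also have "\<Psi> F4 = (\<Sum>i<?m. 1 * \<Psi> (F4' i))"
    unfolding F4_def using F4' by (subst fock_linear_sum[OF \<Psi>]) auto
  also have "\<dots> = dual_aminus2 \<phi> (\<lambda>ks. \<Psi> (tensor_vec ks)) hs"
    unfolding t2 mult_1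
  proof (intro sum.cong refl)
    fix i assume i: "i \<in> {..<?m}"
    show "\<Psi> (F4' i) = (\<Sum>j\<in>{..<?m} - {i}. \<Psi> (tensor_vec ((\<lambda>x. \<phi> x * (hs ! i) x * (hs ! j) x) # nths hs (- {i, j}))))"
      unfolding F4'_def using V4 i by (subst fock_linear_sum[OF \<Psi>]) auto
  qed
  finally show ?thesis by (simp add: dual_R_def)
qed

text \<open>\<open>functional_Rhat_tensor_vec\<close> speaks only of lists of test functions, so
  functionals can be identified only there. Such lists are preserved, because products of test
  functions are test functions.\<close>

lemma dual_R_cong:
  assumes "\<And>ks. set ks \<subseteq> test_functions \<Longrightarrow> \<Phi> ks = \<Phi>' ks" "\<phi> \<in> test_functions" "set hs \<subseteq> test_functions"
  shows "dual_R I \<eta> b c \<phi> \<Phi> hs = dual_R I \<eta> b c \<phi> \<Phi>' hs"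
proof -
  have Z: "dual_azero \<phi> \<Phi> hs = dual_azero \<phi> \<Phi>' hs" if "\<phi> \<in> test_functions" "\<And>ks. set ks \<subseteq> test_functions \<Longrightarrow> \<Phi> ks = \<Phi>' ks" "set hs \<subseteq> test_functions"
    for \<phi> :: "real ^ 'a \<Rightarrow> real" and \<Phi> \<Phi>' hs
    unfolding dual_azero_sum using that(1,3) by (intro sum.cong refl that(2) set_update_test) auto
  have A: "dual_aminus1 I \<phi> \<Phi> hs = dual_aminus1 I \<phi> \<Phi>' hs"
    unfolding dual_aminus1_sum using assms(3)
    by (intro sum.cong arg_cong2[where f="(*)"] refl assms(1) set_nths_test)
  have B: "dual_aminus2 \<phi> \<Phi> hs = dual_aminus2 \<phi> \<Phi>' hs"
    using assms
  proof (induction hs arbitrary: \<Phi> \<Phi>')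
    case (Cons h hs)
    have "dual_aminus2 \<phi> (\<lambda>ks. \<Phi> (h # ks)) hs = dual_aminus2 \<phi> (\<lambda>ks. \<Phi>' (h # ks)) hs"
    proof (rule Cons.IH)
      show "\<Phi> (h # ks) = \<Phi>' (h # ks)" if "set ks \<subseteq> test_functions" for ks
        using Cons.prems(3) that by (intro Cons.prems(1)) auto
    qed (use Cons.prems(2,3) in auto)
    moreover have "dual_azero (\<lambda>x. \<phi> x * h x) \<Phi> hs = dual_azero (\<lambda>x. \<phi> x * h x) \<Phi>' hs"
      using Cons.prems(2,3) by (intro Z Cons.prems(1)) (auto intro: test_functions_mult)
    ultimately show ?case by simp
  next
    case Nil
    show ?case by simp
  qed
  show ?thesis
    using assms(2,3) Z[OF assms(2,1,3)] A B assms(1)[of hs] assms(1)[of "\<phi> # hs"] by (simp add: dual_R_def)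
qed

lemma fold_dual_R_cong:
  assumes "\<And>ks. set ks \<subseteq> test_functions \<Longrightarrow> \<Phi> ks = \<Phi>' ks" "set fs \<subseteq> test_functions" "set hs \<subseteq> test_functions"
  shows "fold (dual_R I \<eta> b c) fs \<Phi> hs = fold (dual_R I \<eta> b c) fs \<Phi>' hs"
  using assms
proof (induction fs arbitrary: \<Phi> \<Phi>')
  case (Cons f fs)
  show ?case
    using Cons.prems by (simp, intro Cons.IH dual_R_cong) auto
next
  case Nil
  show ?case using Nil.prems(1)[OF Nil.prems(3)] by simp
qed

lemma op_prod_list_Cons: "op_prod_list (A # As) = compose Ffin A (op_prod_list As)"
  by (simp add: op_prod_list_def)

lemma op_prod_list_Rhat_in:
  "set fs \<subseteq> test_functions \<Longrightarrow> F \<in> Ffin \<Longrightarrow> op_prod_list (map (Rhat \<eta> \<kappa>) fs) F \<in> Ffin"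
proof (induction fs)
  case Nil
  then show ?case by (simp add: op_prod_list_def op_const_def)
next
  case (Cons f fs)
  then show ?case by (simp add: op_prod_list_Cons compose_def Rhat_in)
qed

text \<open>The leftmost operator is absorbed into \<open>\<Psi>\<close>, which is why
  \<open>\<Psi>\<close> varies in the induction and why \<open>fold\<close> meets the operators from
  the left.\<close>

lemma functional_op_prod_list:
  assumes "fock_linear \<Psi>" "set fs \<subseteq> test_functions"
  shows "\<Psi> (op_prod_list (map (Rhat \<eta> \<kappa>) fs) vac)
    = fold (dual_R leb \<eta> (beta \<eta> \<kappa> + inverse (beta \<eta> \<kappa>) * \<eta>) (inverse (beta \<eta> \<kappa>))) fs (\<lambda>ks. \<Psi> (tensor_vec ks)) []"
  using assms
proof (induction fs arbitrary: \<Psi>)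
  case Nil
  then show ?case by (simp add: op_prod_list_def op_const_def vac_eq tensor_vec_in)
next
  case (Cons f fs)
  let ?T = "dual_R leb \<eta> (beta \<eta> \<kappa> + inverse (beta \<eta> \<kappa>) * \<eta>) (inverse (beta \<eta> \<kappa>))"
  have "\<Psi> (op_prod_list (map (Rhat \<eta> \<kappa>) (f # fs)) vac) = \<Psi> (Rhat \<eta> \<kappa> f (op_prod_list (map (Rhat \<eta> \<kappa>) fs) vac))"
    by (simp add: op_prod_list_Cons compose_def vac_eq tensor_vec_in)
  also have "\<dots> = fold ?T fs (\<lambda>ks. \<Psi> (Rhat \<eta> \<kappa> f (tensor_vec ks))) []"
    using Cons.prems by (intro Cons.IH fock_linear_Rhat) auto
  also have "\<dots> = fold ?T fs (?T f (\<lambda>ks. \<Psi> (tensor_vec ks))) []"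
    using Cons.prems by (intro fold_dual_R_cong functional_Rhat_tensor_vec) auto
  finally show ?case by simp
qed

lemma op_prod_list_rho:
  assumes "set fs \<subseteq> test_functions" "F \<in> Ffin"
  shows "op_prod_list (map (rho \<eta> \<kappa>) fs) F
     = (\<lambda>n xs. (\<kappa> * sqrt (1 + \<eta> * \<kappa>\<^sup>2)) ^ length fs * op_prod_list (map (Rhat \<eta> \<kappa>) fs) F n xs)"
  using assms
proof (induction fs)
  case Nil
  then show ?case by (simp add: op_prod_list_def)
next
  case (Cons f fs)
  then show ?case
    by (simp add: op_prod_list_Cons compose_def op_prod_list_Rhat_in Rhat_scale rho_def op_scale_def Ffin_scale mult.assoc)
qed

text \<open>\<open>tau\<close> is restricted to the algebra generated by \<open>rho\<close> and
  constants. \<open>Rhat\<close> lies in it as \<open>rho\<close> times the reciprocal of a non-zero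
  scalar.\<close>

lemma Rhat_in_density_algebra:
  assumes "\<phi> \<in> test_functions" "\<kappa> > 0" "\<eta> > 0"
  shows "Rhat \<eta> \<kappa> \<phi> \<in> density_algebra \<eta> \<kappa>"
proof -
  define K where "K = \<kappa> * sqrt (1 + \<eta> * \<kappa>\<^sup>2)"
  have "1 + \<eta> * \<kappa>\<^sup>2 > 0" using assms by (simp add: add_pos_nonneg)
  then have K: "K \<noteq> 0" using assms unfolding K_def by simp
  have "Rhat \<eta> \<kappa> \<phi> = compose Ffin (op_const (1 / K)) (rho \<eta> \<kappa> \<phi>)"
  proof (rule extensionalityI[of _ Ffin])
    fix F assume "F \<in> (Ffin :: (real ^ 'a) fock set)"
    then show "Rhat \<eta> \<kappa> \<phi> F = compose Ffin (op_const (1 / K)) (rho \<eta> \<kappa> \<phi>) F"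
      using K by (simp add: compose_def op_const_def rho_def op_scale_def Ffin_scale Rhat_in assms(1) flip: K_def)
  qed (simp_all add: Rhat_def)
  then show ?thesis
    using density_algebra.mult[OF density_algebra.const density_algebra.rho[OF assms(1)]] by metis
qed

lemma op_prod_list_in_density_algebra:
  "set As \<subseteq> density_algebra \<eta> \<kappa> \<Longrightarrow> op_prod_list As \<in> density_algebra \<eta> \<kappa>"
  by (induction As) (simp_all add: op_prod_list_def density_algebra.const density_algebra.mult)

lemma tau_op_prod_list:
  assumes "set fs \<subseteq> test_functions" "\<kappa> > 0" "\<eta> > 0"
  defines "W \<equiv> fold (dual_R leb \<eta> (beta \<eta> \<kappa> + inverse (beta \<eta> \<kappa>) * \<eta>) (inverse (beta \<eta> \<kappa>))) fs vac_functional []"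
  shows "tau \<eta> \<kappa> (op_prod_list (map (Rhat \<eta> \<kappa>) fs)) = W"
    and "tau \<eta> \<kappa> (op_prod_list (map (rho \<eta> \<kappa>) fs)) = (\<kappa> * sqrt (1 + \<eta> * \<kappa>\<^sup>2)) ^ length fs * W"
proof -
  have "fock_linear (\<lambda>F :: (real ^ 'a) fock. F 0 [])" by (simp add: fock_linear_def)
  moreover have "(\<lambda>ks. tensor_vec ks 0 []) = (vac_functional :: (real ^ 'a \<Rightarrow> real) list \<Rightarrow> real)"
    by (auto simp: tensor_vec_def vac_functional_def sym_tensor_def)
  ultimately have W: "op_prod_list (map (Rhat \<eta> \<kappa>) fs) vac 0 [] = W"
    using functional_op_prod_list[of "\<lambda>F. F 0 []" fs] assms(1) by (simp add: W_def)
  have "op_prod_list (map (Rhat \<eta> \<kappa>) fs) \<in> density_algebra \<eta> \<kappa>"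
    "op_prod_list (map (rho \<eta> \<kappa>) fs) \<in> density_algebra \<eta> \<kappa>"
    using assms(1-3) by (auto intro!: op_prod_list_in_density_algebra Rhat_in_density_algebra density_algebra.rho)
  then show "tau \<eta> \<kappa> (op_prod_list (map (Rhat \<eta> \<kappa>) fs)) = W"
    and "tau \<eta> \<kappa> (op_prod_list (map (rho \<eta> \<kappa>) fs)) = (\<kappa> * sqrt (1 + \<eta> * \<kappa>\<^sup>2)) ^ length fs * W"
    using W op_prod_list_rho[OF assms(1), of vac \<eta> \<kappa>] by (simp_all add: tau_def vac_eq tensor_vec_in)
qed

section \<open>Continuous functions with compact support and random measures\<close>

lemma C0_continuous: "f \<in> C0 \<Longrightarrow> continuous_on UNIV f"
  by (simp add: C0_def)

lemma C0_vanish: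
  "f \<in> C0 \<Longrightarrow> continuous_on UNIV g \<Longrightarrow> (\<And>x. f x = 0 \<Longrightarrow> g x = 0) \<Longrightarrow> g \<in> C0"
  by (auto simp: C0_def intro: compactly_supported_subset)

lemma C0_zero: "(\<lambda>_. 0) \<in> C0"
  by (simp add: C0_def compactly_supported_def)

lemma C0_add:
  fixes f :: "real ^ 'd \<Rightarrow> real"
  assumes "f \<in> C0" "g \<in> C0" shows "(\<lambda>x. f x + g x) \<in> C0"
proof -
  \<comment> \<open>In Euclidean space a closure is compact iff the set is bounded, so only
    boundedness of the union matters.\<close>
  have "bounded ({x. f x \<noteq> 0} \<union> {x. g x \<noteq> 0})"
    using assms by (simp add: C0_def compactly_supported_def)
  then have "bounded {x. f x + g x \<noteq> 0}"
    by (rule bounded_subset) auto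
  then show ?thesis
    using assms by (auto simp: C0_def compactly_supported_def intro: continuous_intros)
qed

lemma C0_mult: "f \<in> C0 \<Longrightarrow> g \<in> C0 \<Longrightarrow> (\<lambda>x. f x * g x) \<in> C0"
  by (rule C0_vanish[of f]) (auto intro: continuous_intros C0_continuous)

lemma C0_scale: "f \<in> C0 \<Longrightarrow> (\<lambda>x. c * f x) \<in> C0"
  by (rule C0_vanish[of f]) (auto intro: continuous_intros C0_continuous)

lemma C0_abs: "f \<in> C0 \<Longrightarrow> (\<lambda>x. \<bar>f x\<bar>) \<in> C0"
  by (rule C0_vanish[of f]) (auto intro: continuous_intros C0_continuous)

lemma C0_sum:
  fixes f :: "'i \<Rightarrow> real ^ 'd \<Rightarrow> real"
  shows "(\<And>i. i \<in> S \<Longrightarrow> f i \<in> C0) \<Longrightarrow> (\<lambda>x. \<Sum>i\<in>S. f i x) \<in> C0"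
  by (induction S rule: infinite_finite_induct) (simp_all add: C0_zero C0_add)

lemma C0_bounded:
  assumes "f \<in> C0" obtains B where "B > 0" "\<And>x. \<bar>f x\<bar> \<le> B"
proof -
  let ?K = "closure {x. f x \<noteq> 0}"
  have "compact (f ` ?K)"
    using assms by (intro compact_continuous_image) (auto simp: C0_def compactly_supported_def intro: continuous_on_subset)
  then obtain B where "B > 0" "\<forall>y\<in>f ` ?K. norm y \<le> B"
    using compact_imp_bounded bounded_pos by blast
  moreover have "\<bar>f x\<bar> \<le> B" for x
    using calculation closure_subset[of "{x. f x \<noteq> 0}"] by (cases "f x = 0") auto
  ultimately show thesis using that by blast
qed

lemma C0_integrable:
  assumes "\<mu> \<in> radon_measures" "f \<in> C0" shows "integrable \<mu> f"
proof -
  obtain B where B: "\<And>x. \<bar>f x\<bar> \<le> B" using C0_bounded[OF assms(2)] by blast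
  let ?K = "closure {x. f x \<noteq> 0}"
  have s: "sets \<mu> = sets borel" using assms(1) by (simp add: radon_measures_def)
  have K: "compact ?K" using assms(2) by (simp add: C0_def compactly_supported_def)
  have "f \<in> borel_measurable borel"
    using C0_continuous[OF assms(2)] by (rule borel_measurable_continuous_onI)
  then have "f \<in> borel_measurable \<mu>" using s measurable_cong_sets by blast
  then show ?thesis
    using assms(1) K s B closure_subset[of "{x. f x \<noteq> 0}"]
    by (intro integrableI_bounded_set[where A="?K" and B=B]) (auto simp: radon_measures_def)
qed

lemma lborel_radon: "lborel \<in> radon_measures"
  unfolding radon_measures_def
  by (intro CollectI conjI allI impI emeasure_bounded_finite compact_imp_bounded) simp_all

lemma C0_integrable_lborel: "(f :: real ^ 'd \<Rightarrow> real) \<in> C0 \<Longrightarrow> integrable lborel f"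
  by (rule C0_integrable[OF lborel_radon])

section \<open>Measurability of pairings with a random measure\<close>

lemma vague_open_subset: "{U :: (real ^ 'd) measure set. openin vague_topology U} \<subseteq> Pow radon_measures"
proof -
  have "openin vague_topology U \<Longrightarrow> U \<subseteq> radon_measures" for U :: "(real ^ 'd) measure set"
    using openin_subset[of vague_topology U] unfolding vague_topology_def by auto
  then show ?thesis by auto
qed

text \<open>Preimages of open sets under the pairing are among the sets that generate the vague
  topology.\<close>

lemma borel_measurable_vague:
  assumes "f \<in> C0"
  shows "(\<lambda>\<mu>. \<integral>x. f x \<partial>\<mu>) \<in> borel_measurable (sigma radon_measures {U. openin vague_topology U})"
proof (rule borel_measurableI)
  fix U :: "real set" assume "open U"
  then have "openin vague_topology {\<mu> \<in> radon_measures. (\<integral>x. f x \<partial>\<mu>) \<in> U}"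
    unfolding vague_topology_def using assms by (intro topology_generated_by_Basis) blast
  moreover have "(\<lambda>\<mu>. \<integral>x. f x \<partial>\<mu>) -` U \<inter> space (sigma radon_measures {U. openin vague_topology U})
      = {\<mu> \<in> radon_measures. (\<integral>x. f x \<partial>\<mu>) \<in> U}"
    unfolding space_measure_of[OF vague_open_subset] by auto
  ultimately show "(\<lambda>\<mu>. \<integral>x. f x \<partial>\<mu>) -` U \<inter> space (sigma radon_measures {U. openin vague_topology U})
      \<in> sets (sigma radon_measures {U. openin vague_topology U})"
    unfolding sets_measure_of[OF vague_open_subset] by (auto intro: sigma_sets.Basic)
qed

lemma random_measure_pairing:
  assumes "random_measure P \<gamma>" "f \<in> C0"
  shows "(\<lambda>w. \<integral>x. f x \<partial>\<gamma> w) \<in> borel_measurable P"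
  using measurable_compose[OF _ borel_measurable_vague[OF assms(2)]] assms(1) by (simp add: random_measure_def)

lemma random_measure_radon:
  assumes "random_measure P \<gamma>" "w \<in> space P"
  shows "\<gamma> w \<in> radon_measures"
proof -
  have sp: "space (sigma radon_measures {U. openin vague_topology U}) = (radon_measures :: (real ^ 'b) measure set)"
    by (intro space_measure_of vague_open_subset)
  show ?thesis
    using measurable_space[OF assms(1)[unfolded random_measure_def] assms(2)] unfolding sp .
qed

section \<open>Estimates for exponentials\<close>

lemma power_exp_bounded:
  fixes a :: real
  assumes "a > 0" obtains B where "B \<ge> 0" "\<And>x. x \<ge> 0 \<Longrightarrow> x ^ n * exp (- a * x) \<le> B"
proof -
  \<comment> \<open>Chosen so that \<open>n b \<le> a\<close>, whence
    \<open>(b x)^n \<le> exp (n b x) \<le> exp (a x)\<close>; the added 1 covers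
    \<open>n = 0\<close>.\<close>
  define b where "b = a / (real n + 1)"
  have b: "b > 0" using assms by (simp add: b_def)
  have "x ^ n * exp (- a * x) \<le> inverse (b ^ n)" if "x \<ge> 0" for x
  proof -
    have "(b * x) ^ n \<le> exp (b * x) ^ n"
      using b that exp_ge_add_one_self[of "b * x"] by (intro power_mono) (linarith, simp)
    also have "\<dots> = exp (real n * b * x)" by (simp add: exp_of_nat_mult[symmetric] mult.assoc)
    also have "real n * b \<le> a" using assms by (simp add: b_def field_simps)
    then have "exp (real n * b * x) \<le> exp (a * x)" using that by (simp add: mult_right_mono)
    finally have "b ^ n * x ^ n * exp (- a * x) \<le> exp (a * x) * exp (- a * x)"
      by (intro mult_right_mono) (simp_all add: power_mult_distrib)
    then have "b ^ n * (x ^ n * exp (- a * x)) \<le> 1" by (simp add: mult.assoc flip: exp_add)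
    then show ?thesis using b by (simp add: field_simps)
  qed
  then show thesis using that[of "inverse (b ^ n)"] b by simp
qed

text \<open>Bounds the difference quotients in \<open>moment_derivative\<close> uniformly in the
  increment.\<close>

lemma abs_one_minus_exp_le: "\<bar>1 - exp (- z)\<bar> \<le> \<bar>z\<bar> * exp \<bar>z :: real\<bar>"
proof (cases "z \<ge> 0")
  case True
  have "1 - exp (- z) \<le> z" using exp_ge_add_one_self[of "- z"] by linarith
  also have "z * 1 \<le> z * exp z" using True by (intro mult_left_mono) auto
  finally show ?thesis using True by simp
next
  case False
  have "1 - exp z \<le> - z" using exp_ge_add_one_self[of z] by linarith
  then have "exp (- z) * (1 - exp z) \<le> exp (- z) * (- z)" by (intro mult_left_mono) auto
  then have "exp (- z) - 1 \<le> exp (- z) * (- z)" by (simp add: algebra_simps flip: exp_add)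
  then show ?thesis using False by (simp add: mult.commute)
qed

text \<open>Chain rule for the one-sided derivative at 0, where
  \<open>exp (- Q 0) = 1\<close>.\<close>

lemma exp_quotient_tendsto:
  fixes \<alpha> :: real
  assumes "Q 0 = 0" "((\<lambda>t. Q t / t) \<longlongrightarrow> \<alpha>) (at_right 0)"
  shows "((\<lambda>t. (1 - exp (- Q t)) / t) \<longlongrightarrow> \<alpha>) (at_right 0)"
proof -
  have "(Q has_real_derivative \<alpha>) (at_right 0)"
    using assms by (simp add: has_field_derivative_iff)
  then have "((\<lambda>t. - exp (- Q t)) has_real_derivative \<alpha>) (at_right 0)"
    using assms(1) by (auto intro!: derivative_eq_intros)
  then show ?thesis
    using assms(1) by (simp add: has_field_derivative_iff)
qed

lemma prod_list_replicate_update: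
  fixes x y :: "'a :: comm_monoid_mult"
  shows "i < n \<Longrightarrow> prod_list ((replicate n x)[i := y]) = y * x ^ (n - 1)"
proof (induction n arbitrary: i)
  case (Suc n)
  then show ?case by (cases i; cases n) (auto simp: mult_ac)
qed simp

section \<open>Moments of the gamma measure\<close>

locale gamma_measure = prob_space P
  for P :: "'w measure" and \<gamma> :: "'w \<Rightarrow> (real ^ 'd) measure" and s :: real and g0 :: "real ^ 'd \<Rightarrow> real" +
  assumes s_pos: "s > 0"
    and random: "random_measure P \<gamma>"
    and laplace: "\<And>h. h \<in> C0 \<Longrightarrow> (\<forall>x. h x \<le> 0) \<Longrightarrow>
      (\<integral>w. exp (\<integral>x. h x \<partial>\<gamma> w) \<partial>P) = exp (- (1 / s\<^sup>2) * (\<integral>x. ln (1 - s * h x) \<partial>lborel))"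
    and g0_C0: "g0 \<in> C0" and g0_nonneg: "\<And>x. 0 \<le> g0 x"
begin

definition pair :: "(real ^ 'd \<Rightarrow> real) \<Rightarrow> 'w \<Rightarrow> real" where
  "pair f w = (\<integral>x. f x \<partial>\<gamma> w)"

text \<open>The class is closed under linear combinations and products, and the single random
  variable \<open>pair g0\<close> controls all its pairings.\<close>

definition dominated :: "(real ^ 'd \<Rightarrow> real) set" where
  "dominated = {f \<in> C0. \<exists>K. \<forall>x. \<bar>f x\<bar> \<le> K * g0 x}"

text \<open>For these \<open>h\<close> the weight \<open>exp (pair h w)\<close> is at most
  \<open>exp (- \<epsilon> * pair g0 w)\<close>, which beats every power of \<open>pair g0\<close>.
  Small perturbations by dominated functions stay in the class.\<close>

definition neg :: "(real ^ 'd \<Rightarrow> real) set" where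
  "neg = {h \<in> dominated. \<exists>\<epsilon>>0. \<forall>x. h x \<le> - \<epsilon> * g0 x}"

text \<open>The iterated derivative of the Laplace transform at \<open>h\<close> in the directions
  \<open>fs\<close>, written as an expectation.\<close>

definition moment :: "(real ^ 'd \<Rightarrow> real) list \<Rightarrow> (real ^ 'd \<Rightarrow> real) \<Rightarrow> real" where
  "moment fs h = (\<integral>w. (\<Prod>f\<leftarrow>fs. pair f w) * exp (pair h w) \<partial>P)"

lemma domD: "f \<in> dominated \<Longrightarrow> f \<in> C0"
  by (simp add: dominated_def)

lemma dom_bound: assumes "f \<in> dominated" obtains K where "K > 0" "\<And>x. \<bar>f x\<bar> \<le> K * g0 x"
proof -
  obtain K where K: "\<And>x. \<bar>f x\<bar> \<le> K * g0 x" using assms by (auto simp: dominated_def)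
  have "\<bar>f x\<bar> \<le> (\<bar>K\<bar> + 1) * g0 x" for x
    using K[of x] mult_right_mono[of K "\<bar>K\<bar> + 1" "g0 x"] g0_nonneg[of x] by linarith
  then show thesis using that[of "\<bar>K\<bar> + 1"] by simp
qed

lemma dom_add: assumes "f \<in> dominated" "g \<in> dominated" shows "(\<lambda>x. f x + g x) \<in> dominated"
proof -
  obtain K where K: "\<And>x. \<bar>f x\<bar> \<le> K * g0 x" using dom_bound[OF assms(1)] by blast
  obtain L where L: "\<And>x. \<bar>g x\<bar> \<le> L * g0 x" using dom_bound[OF assms(2)] by blast
  have "\<bar>f x + g x\<bar> \<le> (K + L) * g0 x" for x
    using K[of x] L[of x] by (simp add: distrib_right)
  then show ?thesis using assms C0_add[of f g] unfolding dominated_def by blast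
qed

lemma dom_scale: assumes "f \<in> dominated" shows "(\<lambda>x. c * f x) \<in> dominated"
proof -
  obtain K where K: "\<And>x. \<bar>f x\<bar> \<le> K * g0 x" using dom_bound[OF assms(1)] by blast
  have "\<bar>c * f x\<bar> \<le> (\<bar>c\<bar> * K) * g0 x" for x
    using mult_left_mono[OF K[of x], of "\<bar>c\<bar>"] by (simp add: abs_mult mult.assoc)
  then show ?thesis using assms C0_scale[of f c] unfolding dominated_def by blast
qed

lemma dom_diff: "f \<in> dominated \<Longrightarrow> g \<in> dominated \<Longrightarrow> (\<lambda>x. f x - c * g x) \<in> dominated"
  using dom_add[OF _ dom_scale[of g "- c"], of f] by simp

lemma dom_mult: assumes "f \<in> dominated" "g \<in> dominated" shows "(\<lambda>x. f x * g x) \<in> dominated"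
proof -
  obtain K where K: "K > 0" "\<And>x. \<bar>f x\<bar> \<le> K * g0 x" using dom_bound[OF assms(1)] by blast
  obtain B where B: "B > 0" "\<And>x. \<bar>g x\<bar> \<le> B" using C0_bounded[OF domD[OF assms(2)]] by blast
  have "\<bar>f x * g x\<bar> \<le> (K * B) * g0 x" for x
    using mult_mono[OF K(2)[of x] B(2)[of x]] K(1) g0_nonneg[of x] by (simp add: abs_mult mult_ac)
  then show ?thesis using C0_mult[OF domD domD, OF assms] unfolding dominated_def by blast
qed

lemma g0_dom: "g0 \<in> dominated"
  using g0_C0 g0_nonneg by (auto simp: dominated_def intro!: exI[of _ 1])

lemma neg_dom: "h \<in> neg \<Longrightarrow> h \<in> dominated"
  by (simp add: neg_def)

lemma neg_scale_g0: "r > 0 \<Longrightarrow> (\<lambda>x. - r * g0 x) \<in> neg"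
  using dom_scale[OF g0_dom, of "- r"] by (auto simp: neg_def intro: exI[of _ r])

lemma neg_nonpos: assumes "h \<in> neg" shows "h x \<le> 0"
proof -
  obtain \<epsilon> where "\<epsilon> > 0" "h x \<le> - \<epsilon> * g0 x" using assms by (auto simp: neg_def)
  then show ?thesis using g0_nonneg[of x] by (smt (verit) mult_minus_left mult_nonneg_nonneg)
qed

lemma pair_measurable: "f \<in> dominated \<Longrightarrow> pair f \<in> borel_measurable P"
  unfolding pair_def using random_measure_pairing[OF random domD] .

lemma prod_measurable: "set fs \<subseteq> dominated \<Longrightarrow> (\<lambda>w. \<Prod>f\<leftarrow>fs. pair f w) \<in> borel_measurable P"
proof (induction fs)
  case (Cons f fs)
  then have [measurable]: "pair f \<in> borel_measurable P" "(\<lambda>w. \<Prod>f\<leftarrow>fs. pair f w) \<in> borel_measurable P"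
    by (auto intro: pair_measurable)
  show ?case by simp
qed simp

lemma dom_integrable: "w \<in> space P \<Longrightarrow> f \<in> dominated \<Longrightarrow> integrable (\<gamma> w) f"
  using C0_integrable[OF random_measure_radon[OF random] domD] .

lemma pair_diff:
  "w \<in> space P \<Longrightarrow> f \<in> dominated \<Longrightarrow> g \<in> dominated \<Longrightarrow> pair (\<lambda>x. f x - c * g x) w = pair f w - c * pair g w"
  unfolding pair_def using dom_integrable[of w f] dom_integrable[of w g] by simp

lemma pair_scale: "pair (\<lambda>x. c * f x) w = c * pair f w"
  by (simp add: pair_def)

lemma pair_mono:
  assumes "w \<in> space P" "f \<in> dominated" "g \<in> dominated" "\<And>x. f x \<le> g x" shows "pair f w \<le> pair g w"
  unfolding pair_def using assms by (intro integral_mono dom_integrable)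

lemma pair_g0_nonneg: "pair g0 w \<ge> 0"
  unfolding pair_def using g0_nonneg by (intro Bochner_Integration.integral_nonneg)

lemma pair_abs_le:
  assumes "w \<in> space P" "f \<in> dominated" "\<And>x. \<bar>f x\<bar> \<le> K * g0 x" shows "\<bar>pair f w\<bar> \<le> K * pair g0 w"
proof -
  have "f x \<le> K * g0 x" "- K * g0 x \<le> f x" for x using assms(3)[of x] by (simp_all add: abs_le_iff)
  then have "pair f w \<le> pair (\<lambda>x. K * g0 x) w" "pair (\<lambda>x. - K * g0 x) w \<le> pair f w"
    using assms g0_dom by (blast intro: pair_mono dom_scale)+
  then show ?thesis unfolding pair_scale by simp
qed

lemma prod_bound:
  assumes "set fs \<subseteq> dominated"
  obtains C where "C > 0" "\<And>w. w \<in> space P \<Longrightarrow> \<bar>\<Prod>f\<leftarrow>fs. pair f w\<bar> \<le> C * pair g0 w ^ length fs"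
proof -
  have "\<exists>C>0. \<forall>w\<in>space P. \<bar>\<Prod>f\<leftarrow>fs. pair f w\<bar> \<le> C * pair g0 w ^ length fs"
    using assms
  proof (induction fs)
    case Nil
    then show ?case by (auto intro: exI[of _ 1])
  next
    case (Cons f fs)
    then obtain C where C: "C > 0" "\<And>w. w \<in> space P \<Longrightarrow> \<bar>\<Prod>f\<leftarrow>fs. pair f w\<bar> \<le> C * pair g0 w ^ length fs"
      by auto
    have f: "f \<in> dominated" using Cons.prems by simp
    obtain K where K: "K > 0" "\<And>x. \<bar>f x\<bar> \<le> K * g0 x" using dom_bound[OF f] by blast
    have "\<bar>\<Prod>f\<leftarrow>f # fs. pair f w\<bar> \<le> (K * C) * pair g0 w ^ length (f # fs)" if "w \<in> space P" for w
      using mult_mono[OF pair_abs_le[OF that f K(2)] C(2)[OF that]] K(1) pair_g0_nonneg[of w]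
      by (simp add: abs_mult mult_ac)
    then show ?case using C(1) K(1) by (intro exI[of _ "K * C"]) auto
  qed
  then show thesis using that by blast
qed

section \<open>Integrability and differentiation of weighted moments\<close>

lemma neg_exp_le:
  assumes "h \<in> dominated" "\<And>x. h x \<le> - \<epsilon> * g0 x" "w \<in> space P"
  shows "exp (pair h w) \<le> exp (- \<epsilon> * pair g0 w)"
  using pair_mono[OF assms(3,1) dom_scale[OF g0_dom] assms(2)] unfolding pair_scale by simp

lemma power_g0_exp_bounded:
  assumes "\<epsilon> > 0"
  obtains B where "B \<ge> 0" "\<And>w. pair g0 w ^ n * exp (- \<epsilon> * pair g0 w) \<le> B"
  using power_exp_bounded[OF assms, of n] pair_g0_nonneg by metis

lemma moment_integrable:
  assumes "set fs \<subseteq> dominated" "h \<in> neg"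
  shows "integrable P (\<lambda>w. (\<Prod>f\<leftarrow>fs. pair f w) * exp (pair h w))"
proof -
  obtain C where C: "C > 0" "\<And>w. w \<in> space P \<Longrightarrow> \<bar>\<Prod>f\<leftarrow>fs. pair f w\<bar> \<le> C * pair g0 w ^ length fs"
    using prod_bound[OF assms(1)] by blast
  obtain \<epsilon> where e: "\<epsilon> > 0" "\<And>x. h x \<le> - \<epsilon> * g0 x" using assms(2) by (auto simp: neg_def)
  obtain B where B: "\<And>w. pair g0 w ^ length fs * exp (- \<epsilon> * pair g0 w) \<le> B"
    using power_g0_exp_bounded[OF e(1)] by blast
  have "norm ((\<Prod>f\<leftarrow>fs. pair f w) * exp (pair h w)) \<le> C * B" if w: "w \<in> space P" for w
  proof -
    have "\<bar>\<Prod>f\<leftarrow>fs. pair f w\<bar> * exp (pair h w) \<le> (C * pair g0 w ^ length fs) * exp (- \<epsilon> * pair g0 w)"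
      using C w e neg_exp_le[OF neg_dom[OF assms(2)] e(2) w] pair_g0_nonneg[of w] by (intro mult_mono) auto
    also have "\<dots> \<le> C * B" using B[of w] C(1) by (simp add: mult.assoc)
    finally show ?thesis by (simp add: abs_mult)
  qed
  then show ?thesis
    using prod_measurable[OF assms(1)] pair_measurable[OF neg_dom[OF assms(2)]]
    by (intro integrable_const_bound[where B="C * B"]) auto
qed

text \<open>The constants serve \<open>moment_derivative\<close>: the weight decays at rate
  \<open>2 * \<epsilon>\<close>, and a perturbation \<open>t * f\<close> with \<open>t < b\<close>
  costs at most the rate \<open>b * K \<le> \<epsilon>\<close>, so that a rate
  \<open>\<epsilon>\<close> remains.\<close>

lemma neg_perturb:
  assumes "h \<in> neg" "f \<in> dominated"
  shows "\<exists>b \<epsilon> K. b > 0 \<and> \<epsilon> > 0 \<and> K > 0 \<and> b * K \<le> \<epsilon> \<and> (\<forall>x. h x \<le> - (2 * \<epsilon>) * g0 x) \<and> (\<forall>x. \<bar>f x\<bar> \<le> K * g0 x)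
    \<and> (\<forall>t. 0 < t \<longrightarrow> t < b \<longrightarrow> (\<lambda>x. h x - t * f x) \<in> neg)"
proof -
  obtain \<epsilon> where e: "\<epsilon> > 0" "\<And>x. h x \<le> - \<epsilon> * g0 x" using assms(1) by (auto simp: neg_def)
  obtain K where K: "K > 0" "\<And>x. \<bar>f x\<bar> \<le> K * g0 x" using dom_bound[OF assms(2)] by blast
  \<comment> \<open>Such a perturbation uses up at most half of the decay rate of \<open>h\<close>;
    the rate returned is therefore \<open>\<epsilon> / 2\<close>.\<close>
  define b where "b = \<epsilon> / (2 * K)"
  have b: "b > 0" "b * K = \<epsilon> / 2" using e K by (simp_all add: b_def)
  have "(\<lambda>x. h x - t * f x) \<in> neg" if t: "0 < t" "t < b" for t
  proof -
    have "h x - t * f x \<le> - (\<epsilon> / 2) * g0 x" for x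
    proof -
      have "- (t * f x) \<le> t * \<bar>f x\<bar>" using t by (metis abs_ge_minus_self abs_mult abs_of_pos)
      also have "\<dots> \<le> b * (K * g0 x)" using t K(2)[of x] by (intro mult_mono) auto
      also have "\<dots> = \<epsilon> / 2 * g0 x" using b by (simp flip: mult.assoc)
      finally show ?thesis using e(2)[of x] by simp
    qed
    then show ?thesis
      using e(1) dom_diff[OF neg_dom[OF assms(1)] assms(2)] unfolding neg_def by (auto intro!: exI[of _ "\<epsilon> / 2"])
  qed
  then show ?thesis using b e(1) K e(2)
    by - (rule exI[of _ b], rule exI[of _ "\<epsilon> / 2"], rule exI[of _ K], simp)
qed

lemma eventually_neg_perturb:
  assumes "h \<in> neg" "f \<in> dominated"
  shows "eventually (\<lambda>t. (\<lambda>x. h x - t * f x) \<in> neg) (at_right 0)"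
proof -
  obtain b where "b > 0" "\<forall>t. 0 < t \<longrightarrow> t < b \<longrightarrow> (\<lambda>x. h x - t * f x) \<in> neg"
    using neg_perturb[OF assms] by blast
  then show ?thesis by (auto simp: eventually_at_right_field)
qed

text \<open>Differentiation under the expectation by dominated convergence. The quotients are
  bounded by a multiple of \<open>X^(n+1) exp (- \<epsilon> X)\<close> with
  \<open>X = pair g0 w\<close> and \<open>n\<close> the length of \<open>fs\<close>, hence by a
  constant.\<close>

lemma moment_derivative:
  assumes fs: "set fs \<subseteq> dominated" and h: "h \<in> neg" and f: "f \<in> dominated"
  shows "((\<lambda>t. (moment fs h - moment fs (\<lambda>x. h x - t * f x)) / t) \<longlongrightarrow> moment (f # fs) h) (at_right 0)"
proof -
  obtain b \<epsilon> K where b: "b > 0" and e: "\<epsilon> > 0" and K: "K > 0" and bK: "b * K \<le> \<epsilon>"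
    and he': "\<forall>x. h x \<le> - (2 * \<epsilon>) * g0 x" and fK': "\<forall>x. \<bar>f x\<bar> \<le> K * g0 x"
    and hb': "\<forall>t. 0 < t \<longrightarrow> t < b \<longrightarrow> (\<lambda>x. h x - t * f x) \<in> neg"
    using neg_perturb[OF h f] by blast
  note he = he'[rule_format] and fK = fK'[rule_format] and hb = hb'[rule_format]
  let ?p = "\<lambda>w. \<Prod>f\<leftarrow>fs. pair f w"
  obtain C where C: "C > 0" "\<And>w. w \<in> space P \<Longrightarrow> \<bar>?p w\<bar> \<le> C * pair g0 w ^ length fs"
    using prod_bound[OF fs] by blast
  obtain B where B: "\<And>w. pair g0 w ^ Suc (length fs) * exp (- \<epsilon> * pair g0 w) \<le> B"
    using power_g0_exp_bounded[OF e] by blast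
  define q where "q t w = ?p w * exp (pair h w) * ((1 - exp (- (t * pair f w))) / t)" for t w
  have q: "(moment fs h - moment fs (\<lambda>x. h x - t * f x)) / t = (\<integral>w. q t w \<partial>P)" if t: "0 < t" "t < b" for t
  proof -
    have "(\<integral>w. q t w \<partial>P) = (\<integral>w. (?p w * exp (pair h w) - ?p w * exp (pair (\<lambda>x. h x - t * f x) w)) / t \<partial>P)"
    proof (rule Bochner_Integration.integral_cong[OF refl])
      fix w assume "w \<in> space P"
      then have E: "exp (pair (\<lambda>x. h x - t * f x) w) = exp (pair h w) * exp (- (t * pair f w))"
        using pair_diff[OF _ neg_dom[OF h] f, of w t] by (simp add: mult_exp_exp)
      show "q t w = (?p w * exp (pair h w) - ?p w * exp (pair (\<lambda>x. h x - t * f x) w)) / t"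
        by (simp add: q_def E algebra_simps diff_divide_distrib)
    qed
    also have "\<dots> = (moment fs h - moment fs (\<lambda>x. h x - t * f x)) / t"
      using moment_integrable[OF fs h] moment_integrable[OF fs hb[OF t]] by (simp add: moment_def)
    finally show ?thesis ..
  qed
  have m: "q t \<in> borel_measurable P" for t
    unfolding q_def using prod_measurable[OF fs] pair_measurable[OF neg_dom[OF h]] pair_measurable[OF f] by measurable
  have bound: "norm (q t w) \<le> C * K * B" if t: "0 < t" "t < b" and w: "w \<in> space P" for t w
  proof -
    let ?X = "pair g0 w"
    have X: "?X \<ge> 0" by (rule pair_g0_nonneg)
    have fw: "\<bar>pair f w\<bar> \<le> K * ?X" by (rule pair_abs_le[OF w f fK])
    have "\<bar>t * pair f w\<bar> \<le> t * (K * ?X)" using fw t by (simp add: abs_mult)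
    also have tb: "t * (K * ?X) \<le> b * (K * ?X)" using t K X by (intro mult_right_mono) auto
    also have "\<dots> \<le> \<epsilon> * ?X" using mult_right_mono[OF bK X] by (simp add: mult.assoc)
    finally have tf: "\<bar>t * pair f w\<bar> \<le> \<epsilon> * ?X" .
    have "\<bar>(1 - exp (- (t * pair f w))) / t\<bar> \<le> \<bar>t * pair f w\<bar> * exp \<bar>t * pair f w\<bar> / t"
      using abs_one_minus_exp_le[of "t * pair f w"] t by (simp add: divide_right_mono)
    also have "\<dots> = \<bar>pair f w\<bar> * exp \<bar>t * pair f w\<bar>" using t by (simp add: abs_mult)
    also have "\<dots> \<le> (K * ?X) * exp (\<epsilon> * ?X)" using fw tf K X by (intro mult_mono) auto
    finally have 1: "\<bar>(1 - exp (- (t * pair f w))) / t\<bar> \<le> (K * ?X) * exp (\<epsilon> * ?X)" .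
    have 2: "exp (pair h w) \<le> exp (- (2 * \<epsilon>) * ?X)" by (rule neg_exp_le[OF neg_dom[OF h] he w])
    have "norm (q t w) = \<bar>?p w\<bar> * exp (pair h w) * \<bar>(1 - exp (- (t * pair f w))) / t\<bar>"
      by (simp add: q_def abs_mult)
    also have "\<dots> \<le> (C * ?X ^ length fs) * exp (- (2 * \<epsilon>) * ?X) * ((K * ?X) * exp (\<epsilon> * ?X))"
      using C w X K 1 2 by (intro mult_mono) auto
    also have "\<dots> = C * K * (?X ^ Suc (length fs) * (exp (- (2 * \<epsilon>) * ?X) * exp (\<epsilon> * ?X)))"
      by (simp add: mult_ac)
    also have "exp (- (2 * \<epsilon>) * ?X) * exp (\<epsilon> * ?X) = exp (- \<epsilon> * ?X)"
      by (simp flip: exp_add)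
    also have "C * K * (?X ^ Suc (length fs) * exp (- \<epsilon> * ?X)) \<le> C * K * B"
      using B[of w] C K by (intro mult_left_mono) auto
    finally show ?thesis .
  qed
  have lim: "((\<lambda>t. q t w) \<longlongrightarrow> ?p w * exp (pair h w) * pair f w) (at_right 0)" for w
  proof -
    have "((\<lambda>t. t * pair f w / t) \<longlongrightarrow> pair f w) (at_right 0)"
      by (rule tendsto_eventually) (auto simp: eventually_at_filter)
    then show ?thesis
      unfolding q_def using exp_quotient_tendsto[of "\<lambda>t. t * pair f w"] by (intro tendsto_mult tendsto_const) simp
  qed
  show ?thesis
  \<comment> \<open>Dominated convergence is applied along sequences, so the one-sided limit is
    tested on them.\<close>
  proof (rule tendsto_at_right_sequentially[OF b])
    fix S :: "nat \<Rightarrow> real" assume S: "\<And>n. 0 < S n" "\<And>n. S n < b" "S \<longlonglongrightarrow> 0"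
    have "filterlim S (at_right 0) sequentially"
      using S by (auto simp: filterlim_at less_imp_neq[THEN not_sym])
    then have l: "(\<lambda>n. q (S n) w) \<longlonglongrightarrow> ?p w * exp (pair h w) * pair f w" for w
      using filterlim_compose[OF lim[of w]] by blast
    have "(\<lambda>n. \<integral>w. q (S n) w \<partial>P) \<longlonglongrightarrow> (\<integral>w. ?p w * exp (pair h w) * pair f w \<partial>P)"
    proof (rule integral_dominated_convergence[where w="\<lambda>_. C * K * B"])
      show "(\<lambda>w. ?p w * exp (pair h w) * pair f w) \<in> borel_measurable P"
        using prod_measurable[OF fs] pair_measurable[OF neg_dom[OF h]] pair_measurable[OF f] by measurable
    qed (use m l bound[OF S(1,2)] in auto)
    moreover have "(\<integral>w. ?p w * exp (pair h w) * pair f w \<partial>P) = moment (f # fs) h"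
      by (simp add: moment_def mult_ac)
    ultimately show "(\<lambda>n. (moment fs h - moment fs (\<lambda>x. h x - S n * f x)) / S n) \<longlonglongrightarrow> moment (f # fs) h"
      by (simp only: q[OF S(1,2)])
  qed
qed

lemma moment_continuous:
  assumes "set fs \<subseteq> dominated" "h \<in> neg" "f \<in> dominated"
  shows "((\<lambda>t. moment fs (\<lambda>x. h x - t * f x)) \<longlongrightarrow> moment fs h) (at_right 0)"
proof -
  let ?q = "\<lambda>t. (moment fs h - moment fs (\<lambda>x. h x - t * f x)) / t"
  have "((\<lambda>t. moment fs h - t * ?q t) \<longlongrightarrow> moment fs h - 0 * moment (f # fs) h) (at_right 0)"
    by (intro tendsto_intros moment_derivative[OF assms])
  moreover have "eventually (\<lambda>t. moment fs h - t * ?q t = moment fs (\<lambda>x. h x - t * f x)) (at_right 0)"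
    by (auto simp: eventually_at_filter)
  ultimately show ?thesis
    using Lim_transform_eventually by fastforce
qed


section \<open>Differentiation of the Laplace transform\<close>

lemma log_bounds:
  assumes "g \<in> dominated"
  obtains \<delta> where "\<delta> > 0" "\<And>t x. 0 < t \<Longrightarrow> t < \<delta> \<Longrightarrow> \<bar>s * t * g x\<bar> \<le> 1 / 2"
    "\<And>t. 0 < t \<Longrightarrow> t < \<delta> \<Longrightarrow> (\<lambda>x. ln (1 + s * t * g x)) \<in> C0"
proof -
  obtain B where B: "B > 0" "\<And>x. \<bar>g x\<bar> \<le> B" using C0_bounded[OF domD[OF assms]] by blast
  \<comment> \<open>This keeps \<open>s * t * g x\<close> within 1/2 of zero, where the logarithm is
    defined and its quadratic estimate applies.\<close>
  define \<delta> where "\<delta> = 1 / (2 * s * B)"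
  have d: "\<delta> > 0" "s * \<delta> * B = 1 / 2" using B s_pos by (simp_all add: \<delta>_def)
  have small: "\<bar>s * t * g x\<bar> \<le> 1 / 2" if "0 < t" "t < \<delta>" for t x
  proof -
    have "\<bar>s * t * g x\<bar> = s * t * \<bar>g x\<bar>" using that s_pos by (simp add: abs_mult)
    also have "\<dots> \<le> s * \<delta> * B" using that s_pos B(2)[of x] by (intro mult_mono) auto
    finally show ?thesis using d by simp
  qed
  have "(\<lambda>x. ln (1 + s * t * g x)) \<in> C0" if t: "0 < t" "t < \<delta>" for t
  proof (rule C0_vanish[OF domD[OF assms]])
    have "1 + s * t * g x \<noteq> 0" for x using small[OF t, of x] by auto
    then show "continuous_on UNIV (\<lambda>x. ln (1 + s * t * g x))"
      using C0_continuous[OF domD[OF assms]] by (intro continuous_intros) auto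
  qed simp
  then show thesis using that d small by blast
qed

text \<open>By \<open>|ln (1 + y) - y| \<le> 2 y^2\<close> for \<open>|y| \<le> 1/2\<close>, the
  quotient differs from its limit by at most a constant times \<open>t\<close>, the integral of
  \<open>g^2\<close> being finite.\<close>

lemma log_derivative:
  assumes g: "g \<in> dominated"
  shows "((\<lambda>t. leb (\<lambda>x. ln (1 + s * t * g x)) / t) \<longlongrightarrow> s * leb g) (at_right 0)"
proof -
  obtain \<delta> where d: "\<delta> > 0" "\<And>t x. 0 < t \<Longrightarrow> t < \<delta> \<Longrightarrow> \<bar>s * t * g x\<bar> \<le> 1 / 2"
    "\<And>t. 0 < t \<Longrightarrow> t < \<delta> \<Longrightarrow> (\<lambda>x. ln (1 + s * t * g x)) \<in> C0"
    using log_bounds[OF g] by blast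
  have gi: "integrable lborel g" and g2: "integrable lborel (\<lambda>x. g x * g x)"
    using C0_integrable_lborel domD dom_mult g by blast+
  define M where "M = 2 * s\<^sup>2 * leb (\<lambda>x. g x * g x)"
  have "norm (leb (\<lambda>x. ln (1 + s * t * g x)) / t - s * leb g) \<le> M * t" if t: "0 < t" "t < \<delta>" for t
  proof -
    have li: "integrable lborel (\<lambda>x. ln (1 + s * t * g x))" using C0_integrable_lborel[OF d(3)[OF t]] .
    have "\<bar>leb (\<lambda>x. ln (1 + s * t * g x)) - s * t * leb g\<bar> = \<bar>leb (\<lambda>x. ln (1 + s * t * g x) - s * t * g x)\<bar>"
      using li gi by simp
    also have "\<dots> \<le> leb (\<lambda>x. \<bar>ln (1 + s * t * g x) - s * t * g x\<bar>)"
      by (rule integral_abs_bound)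
    also have "\<dots> \<le> leb (\<lambda>x. 2 * s\<^sup>2 * t\<^sup>2 * (g x * g x))"
    proof (rule integral_mono)
      show "\<bar>ln (1 + s * t * g x) - s * t * g x\<bar> \<le> 2 * s\<^sup>2 * t\<^sup>2 * (g x * g x)" for x
        using abs_ln_one_plus_x_minus_x_bound[OF d(2)[OF t, of x]] by (simp add: power2_eq_square mult_ac)
    qed (use li gi g2 in auto)
    also have "\<dots> = M * t * t" by (simp add: M_def power2_eq_square)
    finally have "\<bar>leb (\<lambda>x. ln (1 + s * t * g x)) - s * t * leb g\<bar> / t \<le> M * t" using t by (simp add: divide_simps)
    moreover have "leb (\<lambda>x. ln (1 + s * t * g x)) / t - s * leb g = (leb (\<lambda>x. ln (1 + s * t * g x)) - s * t * leb g) / t"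
      using t by (simp add: field_simps)
    ultimately show ?thesis using t by (simp add: abs_divide)
  qed
  then have "eventually (\<lambda>t. norm (leb (\<lambda>x. ln (1 + s * t * g x)) / t - s * leb g) \<le> M * t) (at_right 0)"
    using d(1) by (auto simp: eventually_at_right_field)
  moreover have "((\<lambda>t. M * t) \<longlongrightarrow> 0) (at_right 0)"
    by (auto intro!: tendsto_eq_intros)
  ultimately have "((\<lambda>t. leb (\<lambda>x. ln (1 + s * t * g x)) / t - s * leb g) \<longlongrightarrow> 0) (at_right 0)"
    by (rule Lim_null_comparison)
  then show ?thesis by (rule LIM_zero_cancel)
qed

lemma moment_Nil_laplace:
  assumes "h \<in> neg" shows "moment [] h = exp (- (1 / s\<^sup>2) * leb (\<lambda>x. ln (1 - s * h x)))"
  using laplace[OF domD[OF neg_dom[OF assms]]] neg_nonpos[OF assms] by (simp add: moment_def pair_def)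

text \<open>Along \<open>h - t * g * (1 - s * h)\<close> the argument of the logarithm factors as
  \<open>(1 - s * h) * (1 + s * t * g)\<close>.\<close>

lemma moment_Nil_shift:
  assumes h: "h \<in> neg" and g: "g \<in> dominated"
  shows "eventually (\<lambda>t. moment [] (\<lambda>x. h x - t * (g x - s * (g x * h x)))
      = moment [] h * exp (- (leb (\<lambda>x. ln (1 + s * t * g x)) / s\<^sup>2))) (at_right 0)"
proof -
  have G: "(\<lambda>x. g x - s * (g x * h x)) \<in> dominated"
    using g neg_dom[OF h] by (intro dom_diff dom_mult)
  obtain \<delta> where d: "\<delta> > 0" "\<And>t x. 0 < t \<Longrightarrow> t < \<delta> \<Longrightarrow> \<bar>s * t * g x\<bar> \<le> 1 / 2"
    "\<And>t. 0 < t \<Longrightarrow> t < \<delta> \<Longrightarrow> (\<lambda>x. ln (1 + s * t * g x)) \<in> C0"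
    using log_bounds[OF g] by blast
  have pos: "1 - s * h x > 0" for x
    using neg_nonpos[OF h, of x] s_pos by (smt (verit) mult_nonneg_nonpos)
  have "(\<lambda>x. ln (1 - s * h x)) \<in> C0"
  proof (rule C0_vanish[OF domD[OF neg_dom[OF h]]])
    show "continuous_on UNIV (\<lambda>x. ln (1 - s * h x))"
      using C0_continuous[OF domD[OF neg_dom[OF h]]] pos by (intro continuous_intros) (auto simp: less_imp_neq[THEN not_sym])
  qed simp
  then have i1: "integrable lborel (\<lambda>x. ln (1 - s * h x))" by (rule C0_integrable_lborel)
  have "eventually (\<lambda>t. 0 < t \<and> t < \<delta>) (at_right 0)"
    using d(1) by (auto simp: eventually_at_right_field)
  with eventually_neg_perturb[OF h G] show ?thesis
  proof eventually_elim
    case (elim t)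
    then have i2: "integrable lborel (\<lambda>x. ln (1 + s * t * g x))" using C0_integrable_lborel d(3) by blast
    have "ln (1 - s * (h x - t * (g x - s * (g x * h x)))) = ln (1 - s * h x) + ln (1 + s * t * g x)" for x
    proof -
      have "1 + s * t * g x > 0" using d(2)[of t x] elim by auto
      then have "ln ((1 - s * h x) * (1 + s * t * g x)) = ln (1 - s * h x) + ln (1 + s * t * g x)"
        using pos[of x] by (simp add: ln_mult)
      moreover have "1 - s * (h x - t * (g x - s * (g x * h x))) = (1 - s * h x) * (1 + s * t * g x)"
        by (simp add: algebra_simps)
      ultimately show ?thesis by simp
    qed
    then have "leb (\<lambda>x. ln (1 - s * (h x - t * (g x - s * (g x * h x))))) = leb (\<lambda>x. ln (1 - s * h x)) + leb (\<lambda>x. ln (1 + s * t * g x))"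
      using i1 i2 by simp
    then show ?case
      using elim by (simp add: moment_Nil_laplace h diff_divide_distrib add_divide_distrib flip: exp_add)
  qed
qed

section \<open>Integration by parts\<close>

lemma moment_diff:
  assumes "f \<in> dominated" "g \<in> dominated" "set fs \<subseteq> dominated" "h \<in> neg"
  shows "moment ((\<lambda>x. f x - c * g x) # fs) h = moment (f # fs) h - c * moment (g # fs) h"
proof -
  have "moment ((\<lambda>x. f x - c * g x) # fs) h = (\<integral>w. (\<Prod>f\<leftarrow>f # fs. pair f w) * exp (pair h w) - c * ((\<Prod>f\<leftarrow>g # fs. pair f w) * exp (pair h w)) \<partial>P)"
    unfolding moment_def
    by (intro Bochner_Integration.integral_cong refl) (simp add: pair_diff assms algebra_simps)
  also have "\<dots> = moment (f # fs) h - c * moment (g # fs) h"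
    unfolding moment_def using assms moment_integrable[of "f # fs" h] moment_integrable[of "g # fs" h] by simp
  finally show ?thesis .
qed

lemma moment_swap: "moment (f # g # fs) h = moment (g # f # fs) h"
  by (simp add: moment_def mult_ac)

lemma dom_update:
  assumes "set fs \<subseteq> dominated" "g \<in> dominated" "i < length fs"
  shows "set (fs[i := (\<lambda>x. g x * (fs ! i) x)]) \<subseteq> dominated"
  using set_update_subset_insert[of fs i] assms nth_mem[OF assms(3)] by (blast intro: dom_mult)

lemma dual_azero_tendsto:
  assumes "\<And>ks. set ks \<subseteq> dominated \<Longrightarrow> ((\<lambda>t. \<Phi> t ks) \<longlongrightarrow> \<Psi> ks) F" "set fs \<subseteq> dominated" "g \<in> dominated"
  shows "((\<lambda>t. dual_azero g (\<Phi> t) fs) \<longlongrightarrow> dual_azero g \<Psi> fs) F"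
  unfolding dual_azero_sum using assms(2,3) by (intro tendsto_sum assms(1) dom_update) auto

text \<open>Differentiating this identity at \<open>h\<close> in the direction \<open>- f\<close> gives the identity for \<open>f # fs\<close>.\<close>

lemma integration_by_parts:
  assumes "set fs \<subseteq> dominated" "g \<in> dominated" "h \<in> neg"
  shows "moment (g # fs) h = leb g / s * moment fs h + s * moment ((\<lambda>x. g x * h x) # fs) h + s * dual_azero g (\<lambda>ks. moment ks h) fs"
  using assms
proof (induction fs arbitrary: h)
  case Nil
  then have g: "g \<in> dominated" and h: "h \<in> neg" and gh: "(\<lambda>x. g x * h x) \<in> dominated" by (auto intro: dom_mult neg_dom)
  \<comment> \<open>\<open>?G\<close> is \<open>g (1 - s h)\<close>, the direction in which
    \<open>moment_Nil_shift\<close> gives the Laplace transform explicitly; \<open>?Q\<close> is the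
    exponent found there.\<close>
  let ?G = "\<lambda>x. g x - s * (g x * h x)" and ?Q = "\<lambda>t. leb (\<lambda>x. ln (1 + s * t * g x)) / s\<^sup>2"
  have G: "?G \<in> dominated" using g gh by (rule dom_diff)
  have "((\<lambda>t. ?Q t / t) \<longlongrightarrow> s * leb g / s\<^sup>2) (at_right 0)"
    using tendsto_divide[OF log_derivative[OF g] tendsto_const[of "s\<^sup>2"]] s_pos by (simp add: field_simps)
  then have "((\<lambda>t. (1 - exp (- ?Q t)) / t) \<longlongrightarrow> s * leb g / s\<^sup>2) (at_right 0)"
    by (intro exp_quotient_tendsto) simp_all
  then have "((\<lambda>t. moment [] h * ((1 - exp (- ?Q t)) / t)) \<longlongrightarrow> moment [] h * (s * leb g / s\<^sup>2)) (at_right 0)"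
    by (rule tendsto_mult[OF tendsto_const])
  moreover have "eventually (\<lambda>t. moment [] h * ((1 - exp (- ?Q t)) / t) = (moment [] h - moment [] (\<lambda>x. h x - t * ?G x)) / t) (at_right 0)"
    using moment_Nil_shift[OF h g] by eventually_elim (simp add: algebra_simps)
  ultimately have "((\<lambda>t. (moment [] h - moment [] (\<lambda>x. h x - t * ?G x)) / t) \<longlongrightarrow> moment [] h * (s * leb g / s\<^sup>2)) (at_right 0)"
    using Lim_transform_eventually by fast
  \<comment> \<open>The derivative along \<open>?G\<close> is known twice, from the explicit
    transform and as a moment.\<close>
  from tendsto_unique[OF _ moment_derivative[OF _ h G, of "[]"] this]
  have "moment [?G] h = moment [] h * (s * leb g / s\<^sup>2)" by simp
  then have "moment [g] h - s * moment [\<lambda>x. g x * h x] h = leb g / s * moment [] h"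
    using s_pos moment_diff[OF g gh _ h, of "[]" s] by (simp add: power2_eq_square)
  then show ?case by simp
next
  case (Cons f fs)
  then have f: "f \<in> dominated" and fs: "set fs \<subseteq> dominated" and g: "g \<in> dominated" and h: "h \<in> neg" by auto
  let ?h = "\<lambda>t x. h x - t * f x"
  let ?D = "\<lambda>ks t. (moment ks h - moment ks (?h t)) / t"
  have gh: "(\<lambda>x. g x * h x) \<in> dominated" and gf: "(\<lambda>x. g x * f x) \<in> dominated"
    using f g neg_dom[OF h] by (auto intro: dom_mult)
  have D: "(?D ks \<longlongrightarrow> moment (f # ks) h) (at_right 0)" if "set ks \<subseteq> dominated" for ks
    using moment_derivative[OF that h f] .
  \<comment> \<open>Here \<open>m1\<close>, \<open>m2\<close>, \<open>z1\<close> stand for values at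
    \<open>h\<close> and \<open>n1\<close>, \<open>n2\<close>, \<open>n3\<close>, \<open>z2\<close>
    for values at \<open>?h t\<close>. The term \<open>t * n3\<close> comes from
    \<open>g * ?h t = g h - t g f\<close>.\<close>
  have quot: "((a * m1 + s * m2 + s * z1) - (a * n1 + s * (n2 - t * n3) + s * z2)) / t
      = a * ((m1 - n1) / t) + s * ((m2 - n2) / t + n3) + s * ((z1 - z2) / t)" if "t \<noteq> 0" for a m1 m2 n1 n2 n3 z1 z2 t :: real
    using that by (simp add: field_simps)
  have "eventually (\<lambda>t. ?D (g # fs) t = leb g / s * ?D fs t
      + s * (?D ((\<lambda>x. g x * h x) # fs) t + moment ((\<lambda>x. g x * f x) # fs) (?h t))
      + s * dual_azero g (\<lambda>ks. ?D ks t) fs) (at_right 0)"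
    using eventually_neg_perturb[OF h f] eventually_at_right_less[of 0]
  proof eventually_elim
    case (elim t)
    have "moment ((\<lambda>x. g x * ?h t x) # fs) (?h t) = moment ((\<lambda>x. g x * h x) # fs) (?h t) - t * moment ((\<lambda>x. g x * f x) # fs) (?h t)"
      using moment_diff[OF gh gf fs elim(1), of t] by (simp add: algebra_simps)
    note e = Cons.IH[OF fs g elim(1), unfolded this]
    have z: "dual_azero g (\<lambda>ks. ?D ks t) fs = (dual_azero g (\<lambda>ks. moment ks h) fs - dual_azero g (\<lambda>ks. moment ks (?h t)) fs) / t"
      by (simp add: dual_azero_sum sum_subtractf flip: sum_divide_distrib)
    show ?case
      unfolding e Cons.IH[OF fs g h] z by (rule quot) (use elim(2) in simp)
  qed
  moreover have "((\<lambda>t. leb g / s * ?D fs t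
      + s * (?D ((\<lambda>x. g x * h x) # fs) t + moment ((\<lambda>x. g x * f x) # fs) (?h t))
      + s * dual_azero g (\<lambda>ks. ?D ks t) fs) \<longlongrightarrow> leb g / s * moment (f # fs) h
      + s * (moment (f # (\<lambda>x. g x * h x) # fs) h + moment ((\<lambda>x. g x * f x) # fs) h)
      + s * dual_azero g (\<lambda>ks. moment (f # ks) h) fs) (at_right 0)"
    using f fs g h gh gf by (intro tendsto_intros D moment_continuous dual_azero_tendsto) auto
  ultimately have "(?D (g # fs) \<longlongrightarrow> leb g / s * moment (f # fs) h
      + s * (moment (f # (\<lambda>x. g x * h x) # fs) h + moment ((\<lambda>x. g x * f x) # fs) h)
      + s * dual_azero g (\<lambda>ks. moment (f # ks) h) fs) (at_right 0)"
    using tendsto_cong by fast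
  moreover have "(?D (g # fs) \<longlongrightarrow> moment (f # g # fs) h) (at_right 0)"
    using g fs by (intro D) auto
  ultimately have "moment (f # g # fs) h = leb g / s * moment (f # fs) h
      + s * (moment (f # (\<lambda>x. g x * h x) # fs) h + moment ((\<lambda>x. g x * f x) # fs) h)
      + s * dual_azero g (\<lambda>ks. moment (f # ks) h) fs"
    using tendsto_unique[OF trivial_limit_at_right_real] by blast
  \<comment> \<open>The moment with head \<open>g f\<close> is the new first summand of
    \<open>dual_azero\<close> on \<open>f # fs\<close>; the symmetry of moments puts
    \<open>f\<close> behind the head elsewhere.\<close>
  then show ?case
    by (simp add: moment_swap[of f] distrib_left)
qed

section \<open>Removal of the weight\<close>

lemma replicate_dom: "set (replicate n g0) \<subseteq> dominated"
  using g0_dom by auto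

lemma moment_mult_g0: "moment ((\<lambda>x. g x * (- r * g0 x)) # fs) h = - r * moment ((\<lambda>x. g x * g0 x) # fs) h"
proof -
  have "pair (\<lambda>x. g x * (- r * g0 x)) w = - r * pair (\<lambda>x. g x * g0 x) w" for w
    using pair_scale[of "- r" "\<lambda>x. g x * g0 x" w] by (simp add: mult_ac)
  then show ?thesis by (simp add: moment_def mult.assoc)
qed

text \<open>Pointwise \<open>g0^2 \<le> K g0\<close>, and the other factors are
  non-negative.\<close>

lemma moment_replicate_update_le:
  assumes "h \<in> neg" "i < n" "\<And>x. g0 x \<le> K"
  shows "moment ((replicate n g0)[i := (\<lambda>x. g0 x * g0 x)]) h \<le> K * moment (replicate n g0) h"
proof -
  let ?k = "\<lambda>x. g0 x * g0 x"
  have "set ((replicate n g0)[i := ?k]) \<subseteq> dominated"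
    using dom_update[OF replicate_dom g0_dom, of i n] assms(2) by simp
  then have 1: "integrable P (\<lambda>w. (\<Prod>f\<leftarrow>(replicate n g0)[i := ?k]. pair f w) * exp (pair h w))"
    using moment_integrable assms(1) by blast
  have 2: "integrable P (\<lambda>w. (\<Prod>f\<leftarrow>replicate n g0. pair f w) * exp (pair h w))"
    using moment_integrable[OF replicate_dom assms(1)] .
  have "(\<Prod>f\<leftarrow>(replicate n g0)[i := ?k]. pair f w) * exp (pair h w) \<le> K * ((\<Prod>f\<leftarrow>replicate n g0. pair f w) * exp (pair h w))"
    if w: "w \<in> space P" for w
  proof -
    have "pair ?k w \<le> pair (\<lambda>x. K * g0 x) w"
      using assms(3) g0_nonneg by (intro pair_mono w dom_mult dom_scale g0_dom mult_right_mono)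
    then have "pair ?k w * pair g0 w ^ (n - 1) \<le> K * pair g0 w * pair g0 w ^ (n - 1)"
      unfolding pair_scale by (intro mult_right_mono) (simp_all add: pair_g0_nonneg)
    also have "\<dots> = K * pair g0 w ^ n" using assms(2) by (cases n) simp_all
    finally show ?thesis
      using assms(2) by (simp add: map_update prod_list_replicate_update flip: mult.assoc)
  qed
  from integral_mono[OF 1 integrable_mult_right[OF 2] this] show ?thesis
    unfolding moment_def by simp
qed

lemma moment_replicate_bounded:
  "\<exists>B\<ge>0. \<forall>r>0. moment (replicate n g0) (\<lambda>x. - r * g0 x) \<le> B"
proof (induction n)
  case 0
  have "moment [] (\<lambda>x. - r * g0 x) \<le> 1" if "r > 0" for r
  proof -
    have i: "integrable P (\<lambda>w. exp (pair (\<lambda>x. - r * g0 x) w))"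
      using moment_integrable[of "[]", OF _ neg_scale_g0[OF that]] by simp
    have "(\<integral>w. exp (pair (\<lambda>x. - r * g0 x) w) \<partial>P) \<le> (\<integral>w. 1 \<partial>P)"
    proof (rule integral_mono[OF i])
      show "exp (pair (\<lambda>x. - r * g0 x) w) \<le> 1" for w
        using pair_g0_nonneg[of w] that unfolding pair_scale by simp
    qed simp
    then show ?thesis by (simp add: moment_def prob_space)
  qed
  then show ?case by (auto intro: exI[of _ 1])
next
  case (Suc n)
  then obtain B where B: "B \<ge> 0" "\<And>r. r > 0 \<Longrightarrow> moment (replicate n g0) (\<lambda>x. - r * g0 x) \<le> B" by blast
  obtain K where K: "K > 0" "\<And>x. \<bar>g0 x\<bar> \<le> K" using C0_bounded[OF g0_C0] by blast
  then have K': "g0 x \<le> K" for x using abs_le_D1 by blast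
  have leb: "leb g0 \<ge> 0" using g0_nonneg by (simp add: Bochner_Integration.integral_nonneg)
  have "moment (replicate (Suc n) g0) (\<lambda>x. - r * g0 x) \<le> (leb g0 / s + s * (real n * K)) * B" if r: "r > 0" for r
  proof -
    let ?h = "\<lambda>x. - r * g0 x" and ?m = "moment (replicate n g0) (\<lambda>x. - r * g0 x)"
    note h = neg_scale_g0[OF r]
    have "moment ((\<lambda>x. g0 x * ?h x) # replicate n g0) ?h \<le> 0"
    proof -
      have "0 \<le> moment ((\<lambda>x. g0 x * g0 x) # replicate n g0) ?h"
        unfolding moment_def using g0_nonneg pair_g0_nonneg
        by (auto simp: pair_def[of "\<lambda>x. g0 x * g0 x"] intro!: Bochner_Integration.integral_nonneg mult_nonneg_nonneg)
      then show ?thesis unfolding moment_mult_g0 using r by (simp add: mult_nonneg_nonneg)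
    qed
    then have 1: "s * moment ((\<lambda>x. g0 x * ?h x) # replicate n g0) ?h \<le> 0"
      using s_pos by (simp add: mult_nonneg_nonpos)
    have "dual_azero g0 (\<lambda>ks. moment ks ?h) (replicate n g0) \<le> (\<Sum>i<n. K * ?m)"
      unfolding dual_azero_sum
    proof (simp only: length_replicate, rule sum_mono)
      fix i assume "i \<in> {..<n}"
      then show "moment ((replicate n g0)[i := \<lambda>x. g0 x * (replicate n g0 ! i) x]) ?h \<le> K * ?m"
        using moment_replicate_update_le[OF h _ K'] by simp
    qed
    then have 2: "s * dual_azero g0 (\<lambda>ks. moment ks ?h) (replicate n g0) \<le> s * (real n * K) * ?m"
      using s_pos by (simp add: mult.assoc)
    have "moment (replicate (Suc n) g0) ?h \<le> (leb g0 / s + s * (real n * K)) * ?m"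
      using integration_by_parts[OF replicate_dom g0_dom h, of n] 1 2 by (simp add: distrib_right)
    also have "\<dots> \<le> (leb g0 / s + s * (real n * K)) * B"
      using leb s_pos K(1) B(2)[OF r] by (intro mult_left_mono) auto
    finally show ?thesis .
  qed
  then show ?case
    using leb s_pos K(1) B(1) by (intro exI[of _ "(leb g0 / s + s * (real n * K)) * B"]) auto
qed

text \<open>Monotone convergence along \<open>r k = 1 / (k + 1)\<close>: the weighted powers
  increase to the power itself while their expectations stay bounded.\<close>

lemma power_g0_integrable: "integrable P (\<lambda>w. pair g0 w ^ n)"
proof -
  obtain B where B: "\<And>r. r > 0 \<Longrightarrow> moment (replicate n g0) (\<lambda>x. - r * g0 x) \<le> B"
    using moment_replicate_bounded by blast
  define r where "r k = inverse (real (Suc k))" for k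
  have r: "r k > 0" for k by (simp add: r_def)
  have rl: "r \<longlonglongrightarrow> 0" unfolding r_def by (rule LIMSEQ_inverse_real_of_nat)
  have rd: "r l \<le> r k" if "k \<le> l" for k l using that by (simp add: r_def)
  define u where "u k w = pair g0 w ^ n * exp (- r k * pair g0 w)" for k w
  have u: "u k = (\<lambda>w. (\<Prod>f\<leftarrow>replicate n g0. pair f w) * exp (pair (\<lambda>x. - r k * g0 x) w))" for k
    unfolding u_def pair_scale by simp
  have i: "integrable P (u k)" for k
    unfolding u by (rule moment_integrable[OF replicate_dom neg_scale_g0[OF r]])
  have m: "mono (\<lambda>k. u k w)" for w
    unfolding u_def using rd pair_g0_nonneg by (intro monoI mult_left_mono) (auto intro: mult_right_mono)
  have "(\<lambda>k. u k w) \<longlonglongrightarrow> pair g0 w ^ n * exp (- 0 * pair g0 w)" for w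
    unfolding u_def by (intro tendsto_intros rl)
  then have l: "(\<lambda>k. u k w) \<longlonglongrightarrow> pair g0 w ^ n" for w by simp
  have "incseq (\<lambda>k. integral\<^sup>L P (u k))"
    using m by (intro incseq_SucI integral_mono i) (simp add: mono_def)
  moreover have "\<forall>k. integral\<^sup>L P (u k) \<le> B"
    using B[OF r] unfolding u moment_def by blast
  ultimately obtain L where "(\<lambda>k. integral\<^sup>L P (u k)) \<longlonglongrightarrow> L"
    using incseq_convergent by blast
  then show ?thesis
    using m l pair_measurable[OF g0_dom] by (intro integrable_monotone_convergence[OF i]) auto
qed

lemma prod_integrable:
  assumes "set fs \<subseteq> dominated" shows "integrable P (\<lambda>w. \<Prod>f\<leftarrow>fs. pair f w)"
proof -
  obtain C where C: "C > 0" "\<And>w. w \<in> space P \<Longrightarrow> \<bar>\<Prod>f\<leftarrow>fs. pair f w\<bar> \<le> C * pair g0 w ^ length fs"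
    using prod_bound[OF assms] by blast
  show ?thesis
  proof (rule Bochner_Integration.integrable_bound)
    show "integrable P (\<lambda>w. C * pair g0 w ^ length fs)" using power_g0_integrable by simp
    show "AE w in P. norm (\<Prod>f\<leftarrow>fs. pair f w) \<le> norm (C * pair g0 w ^ length fs)"
      using C(2) by (intro AE_I2) (simp add: order_trans[OF _ abs_ge_self])
  qed (rule prod_measurable[OF assms])
qed

section \<open>The recursion for the moments of the gamma measure\<close>

definition expect :: "(real ^ 'd \<Rightarrow> real) list \<Rightarrow> real" where
  "expect fs = (\<integral>w. (\<Prod>f\<leftarrow>fs. pair f w) \<partial>P)"

text \<open>The weight is at most 1, so the absolute value of the product, now known to be
  integrable, dominates.\<close>

lemma moment_tendsto_expect:
  assumes "set fs \<subseteq> dominated"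
  shows "((\<lambda>r. moment fs (\<lambda>x. - r * g0 x)) \<longlongrightarrow> expect fs) (at_right 0)"
proof (rule tendsto_at_right_sequentially[of 0 1])
  fix S :: "nat \<Rightarrow> real" assume S: "\<And>n. 0 < S n" "S \<longlonglongrightarrow> 0"
  let ?p = "\<lambda>w. \<Prod>f\<leftarrow>fs. pair f w"
  show "(\<lambda>n. moment fs (\<lambda>x. - S n * g0 x)) \<longlonglongrightarrow> expect fs"
    unfolding moment_def expect_def pair_scale
  proof (rule integral_dominated_convergence[where w="\<lambda>w. \<bar>?p w\<bar>"])
    show "AE w in P. (\<lambda>n. ?p w * exp (- S n * pair g0 w)) \<longlonglongrightarrow> ?p w"
    proof (rule AE_I2)
      fix w
      have "(\<lambda>n. ?p w * exp (- S n * pair g0 w)) \<longlonglongrightarrow> ?p w * exp (- 0 * pair g0 w)"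
        by (intro tendsto_intros S(2))
      then show "(\<lambda>n. ?p w * exp (- S n * pair g0 w)) \<longlonglongrightarrow> ?p w" by simp
    qed
    show "AE w in P. norm (?p w * exp (- S n * pair g0 w)) \<le> \<bar>?p w\<bar>" for n
    proof (rule AE_I2)
      fix w
      have "exp (- S n * pair g0 w) \<le> 1" using S(1)[of n] pair_g0_nonneg[of w] by simp
      then show "norm (?p w * exp (- S n * pair g0 w)) \<le> \<bar>?p w\<bar>"
        by (simp add: abs_mult mult_left_le)
    qed
    show "integrable P (\<lambda>w. \<bar>?p w\<bar>)" using prod_integrable[OF assms] by simp
    show "?p \<in> borel_measurable P" by (rule prod_measurable[OF assms])
    show "(\<lambda>w. ?p w * exp (- S n * pair g0 w)) \<in> borel_measurable P" for n
      using prod_measurable[OF assms] pair_measurable[OF g0_dom] by measurable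
  qed
qed simp

text \<open>Let \<open>r\<close> tend to 0 in the integration by parts at \<open>h = - r g0\<close>:
  the term containing \<open>h\<close> carries a factor \<open>r\<close> in front of a convergent
  moment and vanishes.\<close>

lemma expect_Cons:
  assumes fs: "set fs \<subseteq> dominated" and g: "g \<in> dominated"
  shows "expect (g # fs) = leb g / s * expect fs + s * dual_azero g expect fs"
proof -
  let ?h = "\<lambda>r x. - r * g0 x"
  have gg: "(\<lambda>x. g x * g0 x) \<in> dominated" using g g0_dom by (rule dom_mult)
  have "eventually (\<lambda>r. moment (g # fs) (?h r) = leb g / s * moment fs (?h r)
      + s * (- r * moment ((\<lambda>x. g x * g0 x) # fs) (?h r)) + s * dual_azero g (\<lambda>ks. moment ks (?h r)) fs) (at_right 0)"
    using eventually_at_right_less[of 0]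
  proof eventually_elim
    case (elim r)
    show ?case
      using integration_by_parts[OF fs g neg_scale_g0[OF elim]] unfolding moment_mult_g0 .
  qed
  moreover have "((\<lambda>r. leb g / s * moment fs (?h r) + s * (- r * moment ((\<lambda>x. g x * g0 x) # fs) (?h r))
      + s * dual_azero g (\<lambda>ks. moment ks (?h r)) fs) \<longlongrightarrow> leb g / s * expect fs
      + s * (- 0 * expect ((\<lambda>x. g x * g0 x) # fs)) + s * dual_azero g expect fs) (at_right 0)"
    using fs g gg by (intro tendsto_intros moment_tendsto_expect dual_azero_tendsto) auto
  ultimately have "((\<lambda>r. moment (g # fs) (?h r)) \<longlongrightarrow> leb g / s * expect fs
      + s * (- 0 * expect ((\<lambda>x. g x * g0 x) # fs)) + s * dual_azero g expect fs) (at_right 0)"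
    using tendsto_cong by fast
  from tendsto_unique[OF _ this moment_tendsto_expect[of "g # fs"]] fs g show ?thesis by simp
qed

text \<open>Both sides satisfy the same recursion. The induction is on the length because
  \<open>dual_azero\<close> alters entries but keeps the length.\<close>

lemma expect_eq_vac_moment:
  assumes "set fs \<subseteq> dominated"
  shows "expect fs = fold (dual_R leb (s\<^sup>2) (2 * s) (1 / s)) fs vac_functional []"
  using assms
proof (induction "length fs" arbitrary: fs)
  case 0
  then show ?case by (simp add: expect_def vac_functional_def prob_space)
next
  case (Suc n)
  then obtain g gs where fs: "fs = g # gs" by (cases fs) auto
  let ?M = "\<lambda>fs. fold (dual_R leb (s\<^sup>2) (2 * s) (1 / s)) fs vac_functional []"
  have g: "g \<in> dominated" "set gs \<subseteq> dominated" "length gs = n" using Suc.prems Suc.hyps(2) fs by auto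
  have "dual_azero g expect gs = dual_azero g ?M gs"
    unfolding dual_azero_sum using g by (intro sum.cong refl Suc.hyps(1) dom_update) auto
  moreover have "expect gs = ?M gs" using Suc.hyps(1)[of gs] g by simp
  ultimately show ?case
    using expect_Cons[OF g(2,1)] vac_moment_Cons[of s leb g gs] s_pos unfolding fs by simp
qed

end

section \<open>The limit of the state\<close>

lemma dual_R_tendsto:
  assumes "\<And>ks. ((\<lambda>t. \<Phi> t ks) \<longlongrightarrow> \<Psi> ks) F" "(b \<longlongrightarrow> b0) F" "(c \<longlongrightarrow> c0) F"
  shows "((\<lambda>t. dual_R I \<eta> (b t) (c t) \<phi> (\<Phi> t) hs) \<longlongrightarrow> dual_R I \<eta> b0 c0 \<phi> \<Psi> hs) F"
proof -
  have Z: "((\<lambda>t. dual_azero \<phi> (\<Phi> t) hs) \<longlongrightarrow> dual_azero \<phi> \<Psi> hs) F" if "\<And>ks. ((\<lambda>t. \<Phi> t ks) \<longlongrightarrow> \<Psi> ks) F" for \<phi> \<Phi> \<Psi> hs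
    unfolding dual_azero_sum by (intro tendsto_sum that)
  have A: "((\<lambda>t. dual_aminus1 I \<phi> (\<Phi> t) hs) \<longlongrightarrow> dual_aminus1 I \<phi> \<Psi> hs) F"
    unfolding dual_aminus1_sum by (intro tendsto_intros assms)
  \<comment> \<open>By recursion on the list, since the closed form \<open>dual_aminus2_sum\<close>
    assumes a symmetric functional.\<close>
  have B: "((\<lambda>t. dual_aminus2 \<phi> (\<Phi> t) hs) \<longlongrightarrow> dual_aminus2 \<phi> \<Psi> hs) F"
    using assms(1)
  proof (induction hs arbitrary: \<Phi> \<Psi>)
    case (Cons h hs)
    have "((\<lambda>t. dual_aminus2 \<phi> (\<lambda>ks. \<Phi> t (h # ks)) hs) \<longlongrightarrow> dual_aminus2 \<phi> (\<lambda>ks. \<Psi> (h # ks)) hs) F"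
      by (rule Cons.IH) (rule Cons.prems)
    then show ?case by (auto intro!: tendsto_intros Z Cons.prems)
  next
    case Nil
    show ?case by simp
  qed
  show ?thesis
    unfolding dual_R_def by (intro tendsto_intros A B Z assms)
qed

lemma fold_dual_R_tendsto:
  assumes "\<And>ks. ((\<lambda>t. \<Phi> t ks) \<longlongrightarrow> \<Psi> ks) F" "(b \<longlongrightarrow> b0) F" "(c \<longlongrightarrow> c0) F"
  shows "((\<lambda>t. fold (dual_R I \<eta> (b t) (c t)) fs (\<Phi> t) hs) \<longlongrightarrow> fold (dual_R I \<eta> b0 c0) fs \<Psi> hs) F"
  using assms(1)
proof (induction fs arbitrary: \<Phi> \<Psi>)
  case (Cons f fs)
  show ?case
    unfolding fold_Cons o_apply by (intro Cons.IH dual_R_tendsto Cons.prems assms)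
next
  case Nil
  show ?case using Nil[of hs] by simp
qed

lemma beta_tendsto:
  assumes "\<eta> > 0"
  shows "((\<lambda>\<kappa>. beta \<eta> \<kappa>) \<longlongrightarrow> sqrt \<eta>) at_top"
proof -
  have "((\<lambda>\<kappa>::real. 1 / \<kappa>\<^sup>2) \<longlongrightarrow> 0) at_top"
    by (intro tendsto_divide_0[OF tendsto_const] filterlim_at_top_imp_at_infinity filterlim_pow_at_top filterlim_ident) simp
  from tendsto_add[OF tendsto_const this, of \<eta>] have "((\<lambda>\<kappa>. sqrt (\<eta> + 1 / \<kappa>\<^sup>2)) \<longlongrightarrow> sqrt (\<eta> + 0)) at_top"
    by (rule tendsto_real_sqrt)
  then show ?thesis by (simp add: beta_def)
qed

text \<open>For fixed \<open>fs\<close> the state depends on \<open>\<kappa>\<close> only through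
  \<open>beta + \<eta> / beta\<close> and \<open>1 / beta\<close>. Their limits
  \<open>2 * sqrt \<eta>\<close> and \<open>1 / sqrt \<eta>\<close> are the coefficients for which
  \<open>dual_R_dual_D\<close> holds with \<open>s = sqrt \<eta>\<close>.\<close>

lemma tau_tendsto:
  assumes "\<eta> > 0" "set fs \<subseteq> test_functions"
  defines "M \<equiv> fold (dual_R leb \<eta> (2 * sqrt \<eta>) (1 / sqrt \<eta>)) fs vac_functional []"
  shows "((\<lambda>\<kappa>. tau \<eta> \<kappa> (op_prod_list (map (Rhat \<eta> \<kappa>) fs))) \<longlongrightarrow> M) at_top"
    and "((\<lambda>\<kappa>. inverse ((\<kappa> * sqrt (1 + \<eta> * \<kappa>\<^sup>2)) ^ length fs)
        * tau \<eta> \<kappa> (op_prod_list (map (rho \<eta> \<kappa>) fs))) \<longlongrightarrow> M) at_top"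
proof -
  define W where "W \<kappa> = fold (dual_R leb \<eta> (beta \<eta> \<kappa> + inverse (beta \<eta> \<kappa>) * \<eta>) (inverse (beta \<eta> \<kappa>))) fs vac_functional []" for \<kappa>
  have s: "sqrt \<eta> > 0" using assms(1) by simp
  have c: "((\<lambda>\<kappa>. inverse (beta \<eta> \<kappa>)) \<longlongrightarrow> inverse (sqrt \<eta>)) at_top"
    using s by (intro tendsto_inverse beta_tendsto assms) simp
  have "((\<lambda>\<kappa>. beta \<eta> \<kappa> + inverse (beta \<eta> \<kappa>) * \<eta>) \<longlongrightarrow> sqrt \<eta> + inverse (sqrt \<eta>) * \<eta>) at_top"
    by (intro tendsto_intros c beta_tendsto assms)
  moreover have "inverse (sqrt \<eta>) * \<eta> = sqrt \<eta>"
    using s real_div_sqrt[of \<eta>] assms(1) by (simp add: divide_inverse mult.commute)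
  ultimately have b: "((\<lambda>\<kappa>. beta \<eta> \<kappa> + inverse (beta \<eta> \<kappa>) * \<eta>) \<longlongrightarrow> 2 * sqrt \<eta>) at_top"
    by simp
  have "(W \<longlongrightarrow> M) at_top"
    unfolding W_def M_def inverse_eq_divide[of "sqrt \<eta>", symmetric]
    by (rule fold_dual_R_tendsto[OF tendsto_const b c])
  moreover have "eventually (\<lambda>\<kappa>. W \<kappa> = tau \<eta> \<kappa> (op_prod_list (map (Rhat \<eta> \<kappa>) fs))) at_top"
    using eventually_gt_at_top[of 0] by eventually_elim (simp add: tau_op_prod_list(1) assms W_def)
  moreover have "eventually (\<lambda>\<kappa>. W \<kappa> = inverse ((\<kappa> * sqrt (1 + \<eta> * \<kappa>\<^sup>2)) ^ length fs)
        * tau \<eta> \<kappa> (op_prod_list (map (rho \<eta> \<kappa>) fs))) at_top"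
    using eventually_gt_at_top[of 0]
  proof eventually_elim
    case (elim \<kappa>)
    have "1 + \<eta> * \<kappa>\<^sup>2 > 0" using assms(1) elim by (simp add: add_pos_nonneg)
    then show ?case
      using elim by (simp add: tau_op_prod_list(2)[OF assms(2) elim assms(1)] W_def)
  qed
  ultimately show "((\<lambda>\<kappa>. tau \<eta> \<kappa> (op_prod_list (map (Rhat \<eta> \<kappa>) fs))) \<longlongrightarrow> M) at_top"
    and "((\<lambda>\<kappa>. inverse ((\<kappa> * sqrt (1 + \<eta> * \<kappa>\<^sup>2)) ^ length fs)
        * tau \<eta> \<kappa> (op_prod_list (map (rho \<eta> \<kappa>) fs))) \<longlongrightarrow> M) at_top"
    using Lim_transform_eventually by fast+
qed

text \<open>Integrability is asserted as well because the Bochner integral of a non-integrable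
  function is 0 by convention.\<close>

theorem corollary33:
  fixes q :: complex and \<eta> :: real
    and P :: "'w measure" and \<gamma> :: "'w \<Rightarrow> (real ^ 'd) measure"
    and f :: "nat \<Rightarrow> real ^ 'd \<Rightarrow> real" and n :: nat
  assumes "CARD('d) \<ge> 2"
    and "cmod q = 1" and "\<eta> = Re q" and "\<eta> > 0"
    and "prob_space P" and "random_measure P \<gamma>"
    and "\<And>h. h \<in> C0 \<Longrightarrow> (\<forall>x. h x \<le> 0) \<Longrightarrow>
           (\<integral>w. exp (\<integral>x. h x \<partial>\<gamma> w) \<partial>P)
             = exp (- (1 / \<eta>) * (\<integral>x. ln (1 - sqrt \<eta> * h x) \<partial>lborel))"
    and "\<And>i. i < n \<Longrightarrow> f i \<in> test_functions"
  shows "integrable P (\<lambda>w. \<Prod>i<n. \<integral>x. f i x \<partial>\<gamma> w)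
    \<and> ((\<lambda>\<kappa>. tau \<eta> \<kappa> (op_prod_list (map (\<lambda>i. Rhat \<eta> \<kappa> (f i)) [0..<n])))
        \<longlongrightarrow> (\<integral>w. (\<Prod>i<n. \<integral>x. f i x \<partial>\<gamma> w) \<partial>P)) at_top
    \<and> ((\<lambda>\<kappa>. inverse ((\<kappa> * sqrt (1 + \<eta> * \<kappa>\<^sup>2)) ^ n)
               * tau \<eta> \<kappa> (op_prod_list (map (\<lambda>i. rho \<eta> \<kappa> (f i)) [0..<n])))
        \<longlongrightarrow> (\<integral>w. (\<Prod>i<n. \<integral>x. f i x \<partial>\<gamma> w) \<partial>P)) at_top"
proof -
  \<comment> \<open>The sum dominates every \<open>f i\<close> with constant 1 and lies in
    \<open>C0\<close>.\<close>
  define g0 where "g0 x = (\<Sum>i<n. \<bar>f i x\<bar>)" for x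
  interpret prob_space P by fact
  interpret gamma_measure P \<gamma> "sqrt \<eta>" g0
  proof unfold_locales
    show "g0 \<in> C0"
      unfolding g0_def using assms(8) by (intro C0_sum C0_abs test_functions_C0) auto
    show "(\<integral>w. exp (\<integral>x. h x \<partial>\<gamma> w) \<partial>P) = exp (- (1 / (sqrt \<eta>)\<^sup>2) * (\<integral>x. ln (1 - sqrt \<eta> * h x) \<partial>lborel))"
      if "h \<in> C0" "\<forall>x. h x \<le> 0" for h
      using assms(7)[OF that] assms(4) by simp
  qed (use assms(4,6) in \<open>auto simp: g0_def intro: sum_nonneg\<close>)
  define fs where "fs = map f [0..<n]"
  have test: "set fs \<subseteq> test_functions" using assms(8) by (auto simp: fs_def)
  have "f i \<in> dominated" if "i < n" for i
  proof -
    have "\<bar>f i x\<bar> \<le> 1 * g0 x" for x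
      using member_le_sum[of i "{..<n}" "\<lambda>i. \<bar>f i x\<bar>"] that by (simp add: g0_def)
    then show ?thesis using test_functions_C0[OF assms(8)[OF that]] unfolding dominated_def by blast
  qed
  then have dom: "set fs \<subseteq> dominated" by (auto simp: fs_def)
  have prod: "(\<Prod>f\<leftarrow>fs. pair f w) = (\<Prod>i<n. \<integral>x. f i x \<partial>\<gamma> w)" for w
    using prod.distinct_set_conv_list[of "[0..<n]" "\<lambda>i. pair (f i) w"]
    by (simp add: fs_def pair_def o_def atLeast0LessThan)
  have e: "fold (dual_R leb \<eta> (2 * sqrt \<eta>) (1 / sqrt \<eta>)) fs vac_functional [] = (\<integral>w. (\<Prod>i<n. \<integral>x. f i x \<partial>\<gamma> w) \<partial>P)"
    using expect_eq_vac_moment[OF dom] assms(4) by (simp add: expect_def prod)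
  show ?thesis
    using prod_integrable[OF dom] tau_tendsto[OF assms(4) test] unfolding e prod
    by (simp add: fs_def o_def)
qed

end
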